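(* Let $K_0\in\mathcal S$, $\varepsilon\in(0,J(K_0)]$, let $T\ge1$ be an integer, $\kappa:=8J(K^* )C_1/C_2$ and $l:=\lceil\kappa\rceil$. Let $K_{t+1}=K_t-2\eta E_{K_t}$ for $t=0,\dots,T-1$, with constant step size $\eta=1/(2C_1)$, where $E_{K_t}\in\mathbb R^{m\times n}$ is an estimate of the exact natural gradient $E^\star_{K_t}$ with error $\delta_t:=E^\star_{K_t}-E_{K_t}$. Suppose that for every $t$ one has $\|\delta_t\|_F^2\le\min\{C_5,C_6,C_7\}$, where $$C_5:=\Big(\frac{\|B\|\sigma_{\min}(Q)}{2(C_4+1)}\Big)^2,\qquad C_6:=\Big(\frac{\sigma_{\min}(\Psi)\,C_2}{1920\,J(K_0)\|B\|C_3^2(C_4+1)}\,\varepsilon\Big)^{2/3},$$ $$C_7:=\frac{C_2}{60J(K_0)}\min\Big(\frac{C_2}{\sigma_{\min}(\Psi)J(K^* )C_1},\frac1{4C_3}\Big)\varepsilon .$$ Then for every $t=0,\dots,T$: 1. (Stability) $K_t\in\mathcal S$. 2. (Monotonicity or convergence) if $t\ge1$, either $J(K_t)\le J(K_{t-1})$ or $J(K_t)-J(K^* )\le\varepsilon$. 3. (Linear rate) $J(K_t)-J(K^* )\le2^{-\lfloor t/l\rfloor}J(K_0)$ as long as $t\le l\cdot\log_2(J(K_0)/\varepsilon)$.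
   Context: Notation: $\|\cdot\|$ is the induced $\ell_2$ matrix norm, $\|\cdot\|_F$ the Frobenius norm, $\rho(\cdot)$ the spectral radius, $\sigma_{\min}(\cdot)$ the smallest singular value. $A\in\mathbb R^{n\times n}$, $B\in\mathbb R^{n\times m}$ with $(A,B)$ controllable; $Q\in\mathbb R^{n\times n}$, $R\in\mathbb R^{m\times m}$, $\Psi\in\mathbb R^{n\times n}$ symmetric positive definite; $\sigma\ge0$. $\mathcal S=\{K\in\mathbb R^{m\times n}:\rho(A-BK)<1\}$. For $K\in\mathcal S$ let $\Sigma_K$, $P_K$ be the unique solutions of $\Sigma_K=\Psi+\sigma^2BB^T+(A-BK)\Sigma_K(A-BK)^T$ and $P_K=Q+K^TRK+(A-BK)^TP_K(A-BK)$; $J(K)=\mathrm{Tr}[(Q+K^TRK)\Sigma_K+\sigma^2R]=\mathrm{Tr}[P_K(\Psi+\sigma^2BB^T)+\sigma^2R]$ for $K\in\mathcal S$ and $J(K)=\infty$ otherwise. $K^*\in\mathcal S$ is the minimizer of $J$. The exact natural gradient at $K\in\mathcal S$ is $E^\star_K=(R+B^TP_KB)K-B^TP_KA$ (so $\delta_t$ is defined whenever $K_t\in\mathcal S$). Constants: $C_1=2[\|R\|+2\sigma_{\min}(\Psi)^{-1}\|B\|^2J(K_0)]$, $C_2=\sigma_{\min}(\Psi)\sigma_{\min}(Q)\sigma_{\min}(R)$, $C_3=J(K_0)/\sigma_{\min}(Q)$, $C_4=\|A\|+\|B\|\sqrt{2J(K_0)/[\sigma_{\min}(\Psi)\sigma_{\min}(R)]}$.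 *)

theory Defs
  imports "HOL-Analysis.Analysis"
begin

text \<open>
  An \<open>n \<times> m\<close> real matrix has type \<open>real^'m^'n\<close> (\<open>'n\<close> indexes the rows).
  On this type the library's \<open>norm\<close> is the Frobenius norm, as the next lemma records;
  the induced \<open>\<ell>\<^sub>2\<close> norm is \<open>op_norm\<close> below. Powers need their own recursion because
  the library's \<open>^\<close> on \<open>real^'n^'n\<close> is the entrywise power.
\<close>

lemma norm_eq_frobenius:
  fixes M :: "real^'m^'n"
  shows "norm M = sqrt (\<Sum>i\<in>UNIV. \<Sum>j\<in>UNIV. (M $ i $ j)\<^sup>2)"
  by (simp add: norm_vec_def L2_set_def sum_nonneg)

definition op_norm :: "real^'m^'n \<Rightarrow> real" where
  "op_norm M = onorm (\<lambda>x. M *v x)"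

primrec matpow :: "real^'n^'n \<Rightarrow> nat \<Rightarrow> real^'n^'n" where
  "matpow M 0 = mat 1"
| "matpow M (Suc k) = M ** matpow M k"

definition mat_spectrum :: "real^'n^'n \<Rightarrow> complex set" where
  "mat_spectrum M = {c. \<exists>v. v \<noteq> 0 \<and> map_matrix complex_of_real M *v v = c *s v}"

definition spectral_radius :: "real^'n^'n \<Rightarrow> real" where
  "spectral_radius M = Max (cmod ` mat_spectrum M)"

text \<open>
  Singular values of a square matrix: the nonnegative square roots of the eigenvalues of
  \<open>M\<^sup>T M\<close>, which are real because that matrix is symmetric.
\<close>

definition singular_values :: "real^'n^'n \<Rightarrow> real set" where
  "singular_values M =
     {s. s \<ge> 0 \<and> (\<exists>v. v \<noteq> 0 \<and> (transpose M ** M) *v v = s\<^sup>2 *s v)}"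

definition sigma_min :: "real^'n^'n \<Rightarrow> real" where
  "sigma_min M = Min (singular_values M)"

definition sym_pos_def :: "real^'n^'n \<Rightarrow> bool" where
  "sym_pos_def M \<longleftrightarrow> transpose M = M \<and> (\<forall>x. x \<noteq> 0 \<longrightarrow> x \<bullet> (M *v x) > 0)"

text \<open>
  Kalman's rank condition: \<open>[B, A B, \<dots>, A\<^sup>n\<^sup>-\<^sup>1 B]\<close> has rank \<open>n\<close>, the rank of this block matrix
  being the dimension of the span of the columns of its blocks.
\<close>

definition controllable :: "real^'n^'n \<Rightarrow> real^'m^'n \<Rightarrow> bool" where
  "controllable A B \<longleftrightarrow> dim (\<Union>k<CARD('n). columns (matpow A k ** B)) = CARD('n)"

definition stabilizing :: "real^'n^'n \<Rightarrow> real^'m^'n \<Rightarrow> (real^'n^'m) set" where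
  "stabilizing A B = {K. spectral_radius (A - B ** K) < 1}"

text \<open>
  The two Lyapunov equations have a unique solution when \<open>K\<close> is stabilizing; for other \<open>K\<close>
  the values of \<open>state_cov\<close>, \<open>value_matrix\<close> and \<open>natural_gradient\<close> carry no meaning.
\<close>

definition state_cov ::
  "real^'n^'n \<Rightarrow> real^'m^'n \<Rightarrow> real^'n^'n \<Rightarrow> real \<Rightarrow> real^'n^'m \<Rightarrow> real^'n^'n" where
  "state_cov A B \<Psi> \<sigma> K =
     (THE S. S = \<Psi> + \<sigma>\<^sup>2 *\<^sub>R (B ** transpose B)
               + (A - B ** K) ** S ** transpose (A - B ** K))"

definition value_matrix ::
  "real^'n^'n \<Rightarrow> real^'m^'n \<Rightarrow> real^'n^'n \<Rightarrow> real^'m^'m \<Rightarrow> real^'n^'m \<Rightarrow> real^'n^'n" where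
  "value_matrix A B Q R K =
     (THE P. P = Q + transpose K ** R ** K
               + transpose (A - B ** K) ** P ** (A - B ** K))"

text \<open>
  The cost is usually written \<open>Tr[(Q + K\<^sup>T R K) \<Sigma> + \<sigma>\<^sup>2 R]\<close>. The two summands are of size
  \<open>n \<times> n\<close> and \<open>m \<times> m\<close>, so the trace has to be taken of each separately.
\<close>

definition lqr_cost ::
  "real^'n^'n \<Rightarrow> real^'m^'n \<Rightarrow> real^'n^'n \<Rightarrow> real^'m^'m \<Rightarrow> real^'n^'n \<Rightarrow> real
     \<Rightarrow> real^'n^'m \<Rightarrow> ereal" where
  "lqr_cost A B Q R \<Psi> \<sigma> K =
     (if K \<in> stabilizing A B
      then ereal (trace ((Q + transpose K ** R ** K) ** state_cov A B \<Psi> \<sigma> K)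
                  + trace (\<sigma>\<^sup>2 *\<^sub>R R))
      else \<infinity>)"

definition natural_gradient ::
  "real^'n^'n \<Rightarrow> real^'m^'n \<Rightarrow> real^'n^'n \<Rightarrow> real^'m^'m \<Rightarrow> real^'n^'m \<Rightarrow> real^'n^'m" where
  "natural_gradient A B Q R K =
     (R + transpose B ** value_matrix A B Q R K ** B) ** K
       - transpose B ** value_matrix A B Q R K ** A"

end

theory Submission
  imports Defs "HOL-Computational_Algebra.Fundamental_Theorem_Algebra"
begin

text \<open>
  The value matrix \<open>P\<^sub>K\<close> is a Lyapunov function for the next closed loop. Writing
  \<open>K' = K - s (E - \<Delta>)\<close> with \<open>s = 1 / C1\<close>, the Bellman defect of \<open>P\<^sub>K\<close> under \<open>K'\<close> is a quadratic form
  bounded by \<open>s (\<parallel>\<Delta> x\<parallel>\<^sup>2 - \<parallel>E x\<parallel>\<^sup>2)\<close>, since \<open>C1\<close> is at least twice the norm of \<open>R + B\<^sup>T P\<^sub>K B\<close> as long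
  as \<open>J K \<le> 2 J0\<close>. If \<open>s \<parallel>\<Delta>\<parallel>\<^sup>2 < \<sigma>\<^sub>m\<^sub>i\<^sub>n Q\<close>, then \<open>P\<^sub>K\<close> still decreases along the new closed loop, so
  \<open>K'\<close> is stabilizing without any perturbation bound on the state covariance. Pairing the defect
  with that covariance and using gradient domination yields
  \<open>a\<^sub>t\<^sub>+\<^sub>1 \<le> (1 - \<theta>) a\<^sub>t + \<theta> \<epsilon> / 40\<close> for \<open>a\<^sub>t = J K\<^sub>t - J K\<^sup>*\<close> and \<open>\<theta> = 8 / \<kappa>\<close>; all three claims follow
  from this recursion.
\<close>

section \<open>Spectrum and powers of a real matrix\<close>

text \<open>The vector \<open>p(M) x\<close>. It is built from iterates of the map
  \<open>x \<mapsto> M x\<close> because the power notation on matrices is entrywise.\<close>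

definition poly_act :: "complex^'n^'n \<Rightarrow> complex poly \<Rightarrow> complex^'n \<Rightarrow> complex^'n" where
  "poly_act M p x = (\<Sum>k\<le>degree p. coeff p k *s (((*v) M ^^ k) x))"

lemma poly_act_extend:
  assumes "degree p \<le> N"
  shows "poly_act M p x = (\<Sum>k\<le>N. coeff p k *s (((*v) M ^^ k) x))"
  unfolding poly_act_def
  by (rule sum.mono_neutral_left) (use assms in \<open>auto simp: coeff_eq_0\<close>)

lemma poly_act_add: "poly_act M (p + q) x = poly_act M p x + poly_act M q x"
proof -
  let ?N = "max (degree p) (degree q)"
  show ?thesis
    using degree_add_le_max[of p q]
    by (simp add: poly_act_extend[of _ ?N] vector_sadd_rdistrib sum.distrib)
qed

lemma poly_act_smult: "poly_act M (smult c p) x = c *s poly_act M p x"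
  by (simp add: poly_act_extend[of "smult c p" "degree p"] poly_act_def vec.scale_sum_right
      vector_smult_assoc degree_smult_le)

lemma poly_act_pCons: "poly_act M (pCons a p) x = a *s x + poly_act M p (M *v x)"
proof -
  have "poly_act M (pCons a p) x = (\<Sum>k\<le>Suc (degree p). coeff (pCons a p) k *s (((*v) M ^^ k) x))"
    by (rule poly_act_extend) (rule degree_pCons_le)
  also have "\<dots> = a *s x + poly_act M p (M *v x)"
    by (subst sum.atMost_Suc_shift) (simp add: poly_act_def funpow_swap1)
  finally show ?thesis .
qed

lemma poly_act_diff_arg: "poly_act M p (x - y) = poly_act M p x - poly_act M p y"
proof -
  have "((*v) M ^^ k) (x - y) = ((*v) M ^^ k) x - ((*v) M ^^ k) y" for k
    by (induction k) (simp_all add: matrix_vector_mult_diff_distrib)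
  then show ?thesis by (simp add: poly_act_def vector_ssub_ldistrib sum_subtractf)
qed

lemma poly_act_scale_arg: "poly_act M p (c *s x) = c *s poly_act M p x"
proof -
  have "((*v) M ^^ k) (c *s x) = c *s ((*v) M ^^ k) x" for k
    by (induction k) (simp_all add: vector_scalar_commute)
  then show ?thesis by (simp add: poly_act_def vec.scale_sum_right vector_smult_assoc mult.commute)
qed

text \<open>Peeling off a root \<open>c\<close> amounts to replacing \<open>x\<close> by
  \<open>(M - c) x\<close>, which lets inductions over linear factors run with an arbitrary
  vector.\<close>

lemma poly_act_linear_factor:
  "poly_act M ([:- c, 1:] * q) x = poly_act M q (M *v x - c *s x)"
proof -
  have "poly_act M ([:- c, 1:] * q) x = poly_act M (smult (- c) q + pCons 0 q) x"
    by (simp add: mult_pCons_left)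
  then show ?thesis
    by (simp only: poly_act_add poly_act_smult poly_act_pCons poly_act_diff_arg poly_act_scale_arg) simp
qed

lemma poly_act_commute: "poly_act M q (M *v x - c *s x) = M *v poly_act M q x - c *s poly_act M q x"
proof -
  have "poly_act M q (M *v x) = M *v poly_act M q x"
    by (simp add: poly_act_def vec.linear_sum vector_scalar_commute funpow_swap1
        matrix_vector_mul_linear_gen vec.linear_sum[OF matrix_vector_mul_linear_gen])
  then show ?thesis by (simp add: poly_act_diff_arg poly_act_scale_arg)
qed

lemma poly_act_eigenvector:
  assumes "M *v v = c *s v"
  shows "poly_act M p v = poly p c *s v"
proof -
  have "((*v) M ^^ k) v = c ^ k *s v" for k
    by (induction k) (simp_all add: vector_scalar_commute assms vector_smult_assoc mult.commute)
  then show ?thesis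
    by (simp add: poly_act_def poly_altdef vector_smult_assoc vec.scale_sum_left)
qed

section \<open>Eigenvectors and orbit decay by splitting off roots\<close>

text \<open>The fundamental theorem of algebra supplies a root, and dividing it out lowers the
  degree. The factorisation into linear factors thus becomes an induction rule.\<close>

lemma complex_poly_linear_factor_induct [consumes 1, case_names const factor]:
  fixes p :: "complex poly"
  assumes "p \<noteq> 0"
    and "\<And>a. a \<noteq> 0 \<Longrightarrow> P [:a:]"
    and "\<And>c q. q \<noteq> 0 \<Longrightarrow> P q \<Longrightarrow> P ([:- c, 1:] * q)"
  shows "P p"
  using assms(1)
proof (induction "degree p" arbitrary: p)
  case 0
  then show ?case using assms(2) by (metis degree_eq_zeroE pCons_eq_0_iff)
next
  case (Suc d)
  then have "\<not> constant (poly p)" by (simp add: constant_degree)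
  then obtain c where "poly p c = 0" using fundamental_theorem_of_algebra by blast
  then obtain q where q: "p = [:- c, 1:] * q" by (auto simp: poly_eq_0_iff_dvd)
  with Suc have "q \<noteq> 0" by auto
  then have "degree p = Suc (degree q)" unfolding q by (subst degree_mult_eq) auto
  with Suc \<open>q \<noteq> 0\<close> have "P q" by simp
  with assms(3) \<open>q \<noteq> 0\<close> q show ?case by blast
qed

text \<open>For a factor \<open>M - c\<close>, either \<open>x\<close> is already an eigenvector, or
  \<open>(M - c) x\<close> is a nonzero vector killed by the remaining factors.\<close>

lemma annihilating_poly_exists_eigenvector:
  assumes "p \<noteq> 0" "x \<noteq> 0" "poly_act M p x = 0"
  shows "\<exists>c v. v \<noteq> 0 \<and> M *v v = c *s v"
  using assms
proof (induction p arbitrary: x rule: complex_poly_linear_factor_induct)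
  case (const a)
  then show ?case by (simp add: poly_act_def)
next
  case (factor c q)
  show ?case
  proof (cases "M *v x = c *s x")
    case True
    with factor show ?thesis by blast
  next
    case False
    then show ?thesis
      using factor.IH[of "M *v x - c *s x"] factor.prems(2) unfolding poly_act_linear_factor by simp
  qed
qed

text \<open>Summing the recursion bounds each partial sum by \<open>cmod c\<close> times itself plus
  a constant; \<open>cmod c < 1\<close> allows solving for it.\<close>

lemma summable_norm_affine_recursion:
  fixes x y :: "nat \<Rightarrow> complex^'n"
  assumes "\<And>k. x (Suc k) = c *s x k + y k" "cmod c < 1" "summable (\<lambda>k. norm (y k))"
  shows "summable (\<lambda>k. norm (x k))"
proof (rule bounded_imp_summable[of _ "(norm (x 0) + (\<Sum>k. norm (y k))) / (1 - cmod c)"])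
  fix n
  have ns: "norm (c *s v) = cmod c * norm v" for v :: "complex^'n"
    by (simp add: norm_vec_def norm_mult L2_set_right_distrib)
  have sx: "(\<Sum>k\<le>n. norm (x k)) \<le> norm (x 0) + cmod c * (\<Sum>k<n. norm (x k)) + (\<Sum>k<n. norm (y k))" for n
  proof (induction n)
    case (Suc n)
    have "norm (x (Suc n)) \<le> cmod c * norm (x n) + norm (y n)"
      unfolding assms(1) ns[symmetric] by (rule norm_triangle_ineq)
    with Suc show ?case by (simp add: algebra_simps)
  qed simp
  have "(\<Sum>k<n. norm (y k)) \<le> (\<Sum>k. norm (y k))"
    by (rule sum_le_suminf) (use assms(3) in auto)
  moreover have "cmod c * (\<Sum>k<n. norm (x k)) \<le> cmod c * (\<Sum>k\<le>n. norm (x k))"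
    by (intro mult_left_mono sum_mono2) auto
  ultimately have "(1 - cmod c) * (\<Sum>k\<le>n. norm (x k)) \<le> norm (x 0) + (\<Sum>k. norm (y k))"
    using sx[of n] by (simp add: algebra_simps)
  then show "(\<Sum>k\<le>n. norm (x k)) \<le> (norm (x 0) + (\<Sum>k. norm (y k))) / (1 - cmod c)"
    using assms(2) by (simp add: field_simps)
qed simp

text \<open>Decay of orbits without Jordan form. For a root inside the unit disc, the orbit of
  \<open>x\<close> obeys an affine recursion driven by the summable orbit of
  \<open>(M - c) x\<close>. For any other root, \<open>q(M) x\<close> would be an eigenvector with a
  forbidden eigenvalue unless it is zero, so \<open>q\<close> alone already annihilates
  \<open>x\<close>.\<close>

lemma annihilating_poly_summable_orbit:
  assumes "p \<noteq> 0" "poly_act M p x = 0"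
    and "\<And>c v. v \<noteq> 0 \<Longrightarrow> M *v v = c *s v \<Longrightarrow> cmod c < 1"
  shows "summable (\<lambda>k. norm (((*v) M ^^ k) x))"
  using assms(1,2)
proof (induction p arbitrary: x rule: complex_poly_linear_factor_induct)
  case (const a)
  then have "x = 0" by (simp add: poly_act_def)
  moreover have "((*v) M ^^ k) 0 = 0" for k by (induction k) auto
  ultimately show ?case by simp
next
  case (factor c q)
  show ?case
  proof (cases "cmod c < 1")
    case True
    let ?y = "M *v x - c *s x"
    have "summable (\<lambda>k. norm (((*v) M ^^ k) ?y))"
      using factor unfolding poly_act_linear_factor by blast
    moreover have "((*v) M ^^ k) ?y = ((*v) M ^^ Suc k) x - c *s ((*v) M ^^ k) x" for k
      by (induction k) (simp_all add: matrix_vector_mult_diff_distrib vector_scalar_commute)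
    ultimately show ?thesis
      by (intro summable_norm_affine_recursion[OF _ True, of "\<lambda>k. ((*v) M ^^ k) x" "\<lambda>k. ((*v) M ^^ k) ?y"]) auto
  next
    case False
    have "M *v poly_act M q x = c *s poly_act M q x"
      using factor.prems unfolding poly_act_linear_factor by (simp add: poly_act_commute)
    with False assms(3) have "poly_act M q x = 0" by blast
    with factor show ?thesis by blast
  qed
qed

section \<open>Transfer to real matrices and the spectral radius\<close>

lemma map_matrix_of_real_mult_vec:
  "map_matrix complex_of_real (A ** B) *v x
     = map_matrix complex_of_real A *v (map_matrix complex_of_real B *v x)"
proof -
  have "map_matrix complex_of_real (A ** B) = map_matrix complex_of_real A ** map_matrix complex_of_real B"
    by (simp add: vec_eq_iff matrix_matrix_mult_def)
  then show ?thesis by (simp add: matrix_vector_mul_assoc)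
qed

lemma map_matrix_of_real_matpow:
  "map_matrix complex_of_real (matpow A k) *v x = ((*v) (map_matrix complex_of_real A) ^^ k) x"
proof (induction k)
  case 0
  have "map_matrix complex_of_real (mat 1) = (mat 1 :: complex^'a^'a)"
    by (simp add: vec_eq_iff mat_def)
  then show ?case by simp
qed (simp add: map_matrix_of_real_mult_vec)

text \<open>More terms than the dimension are dependent. Dependence is a notion for sets, so a
  repeated term is treated separately, with coefficients \<open>1\<close> and \<open>-1\<close> at
  the two equal positions.\<close>

lemma real_dependence_of_sequence:
  fixes f :: "nat \<Rightarrow> 'a::euclidean_space"
  shows "\<exists>N a. (\<exists>k\<le>N. a k \<noteq> 0) \<and> (\<Sum>k\<le>N. a k *\<^sub>R f k) = 0"
proof -
  let ?N = "DIM('a)"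
  show ?thesis
  proof (cases "inj_on f {..?N}")
    case True
    then have "card (f ` {..?N}) = Suc ?N" by (simp add: card_image)
    then have "dependent (f ` {..?N})" by (intro dependent_biggerset) auto
    then obtain u where u: "\<exists>v\<in>f ` {..?N}. u v \<noteq> 0" "(\<Sum>v\<in>f ` {..?N}. u v *\<^sub>R v) = 0"
      by (auto simp: dependent_finite)
    from u(2) have "(\<Sum>k\<le>?N. u (f k) *\<^sub>R f k) = 0"
      by (simp add: sum.reindex[OF True])
    with u(1) show ?thesis by (intro exI[of _ ?N] exI[of _ "\<lambda>k. u (f k)"]) auto
  next
    case False
    then obtain i j where ij: "i \<le> ?N" "j \<le> ?N" "i \<noteq> j" "f i = f j" by (auto simp: inj_on_def)
    define a :: "nat \<Rightarrow> real" where "a = (\<lambda>k. (if k = i then 1 else 0) - (if k = j then 1 else 0))"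
    have "a k *\<^sub>R f k = (if k = i then f k else 0) - (if k = j then f k else 0)" for k
      by (simp add: a_def)
    then have "(\<Sum>k\<le>?N. a k *\<^sub>R f k) = 0"
      using ij by (simp add: sum_subtractf)
    moreover have "a i \<noteq> 0" using ij by (simp add: a_def)
    ultimately show ?thesis using ij by blast
  qed
qed

text \<open>The powers of \<open>A\<close> live in a finite-dimensional space of matrices, so they
  are linearly dependent. This weak form of Cayley-Hamilton suffices, since the degree is
  irrelevant.\<close>

lemma annihilating_poly_exists:
  fixes A :: "real^'n^'n"
  shows "\<exists>p. p \<noteq> 0 \<and> (\<forall>x. poly_act (map_matrix complex_of_real A) p x = 0)"
proof -
  let ?M = "map_matrix complex_of_real A"
  obtain N a k0 where a: "k0 \<le> N" "a k0 \<noteq> 0" "(\<Sum>k\<le>N. a k *\<^sub>R matpow A k) = 0"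
    using real_dependence_of_sequence[of "matpow A"] by blast
  define p where "p = (\<Sum>k\<le>N. monom (complex_of_real (a k)) k)"
  have cp: "coeff p k = (if k \<le> N then complex_of_real (a k) else 0)" for k
    by (auto simp: p_def coeff_sum)
  have "p \<noteq> 0" using a cp[of k0] by auto
  moreover have "poly_act ?M p x = 0" for x
  proof -
    have "degree p \<le> N" by (rule degree_le) (simp add: cp)
    then have "poly_act ?M p x
        = (\<Sum>k\<le>N. complex_of_real (a k) *s (map_matrix complex_of_real (matpow A k) *v x))"
      by (simp add: poly_act_extend[of _ N] cp map_matrix_of_real_matpow)
    also have "\<dots> = map_matrix complex_of_real (\<Sum>k\<le>N. a k *\<^sub>R matpow A k) *v x"
      by (simp add: vec_eq_iff matrix_vector_mult_def sum_distrib_left sum_distrib_right mult.assoc)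
        (subst sum.swap, simp)
    also have "\<dots> = 0" unfolding a(3) by (simp add: vec_eq_iff matrix_vector_mult_def)
    finally show ?thesis .
  qed
  ultimately show ?thesis by blast
qed

lemma finite_mat_spectrum: "finite (mat_spectrum A)"
proof -
  let ?M = "map_matrix complex_of_real A"
  obtain p where p: "p \<noteq> 0" "\<And>x. poly_act ?M p x = 0" using annihilating_poly_exists by blast
  have "mat_spectrum A \<subseteq> {c. poly p c = 0}"
  proof
    fix c assume "c \<in> mat_spectrum A"
    then obtain v where "v \<noteq> 0" "?M *v v = c *s v" by (auto simp: mat_spectrum_def)
    with p(2)[of v] show "c \<in> {c. poly p c = 0}" by (simp add: poly_act_eigenvector)
  qed
  then show ?thesis using poly_roots_finite[OF p(1)] finite_subset by blast
qed

lemma mat_spectrum_nonempty: "mat_spectrum A \<noteq> {}"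
proof -
  obtain p where p: "p \<noteq> 0" "\<And>x. poly_act (map_matrix complex_of_real A) p x = 0"
    using annihilating_poly_exists by blast
  have "(1 :: complex^'a) \<noteq> 0" by (simp add: vec_eq_iff)
  from annihilating_poly_exists_eigenvector[OF p(1) this p(2)] show ?thesis
    by (auto simp: mat_spectrum_def)
qed

text \<open>The maximum is over a finite nonempty set: eigenvalues are roots of an annihilating
  polynomial, and at least one exists.\<close>

lemma spectral_radius_less_iff: "spectral_radius A < r \<longleftrightarrow> (\<forall>c\<in>mat_spectrum A. cmod c < r)"
  by (simp add: spectral_radius_def finite_mat_spectrum mat_spectrum_nonempty)

lemma spectral_radius_less_1_tendsto_0:
  fixes A :: "real^'n^'n"
  assumes "spectral_radius A < 1"
  shows "(\<lambda>k. matpow A k *v x) \<longlonglongrightarrow> 0"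
proof -
  let ?M = "map_matrix complex_of_real A"
  let ?x = "(\<chi> i. complex_of_real (x $ i))"
  obtain p where p: "p \<noteq> 0" "\<And>x. poly_act ?M p x = 0" using annihilating_poly_exists by blast
  have "summable (\<lambda>k. norm (((*v) ?M ^^ k) ?x))"
    by (rule annihilating_poly_summable_orbit[OF p])
      (use assms in \<open>auto simp: spectral_radius_less_iff mat_spectrum_def\<close>)
  then have "(\<lambda>k. ((*v) ?M ^^ k) ?x) \<longlonglongrightarrow> 0"
    using summable_LIMSEQ_zero tendsto_norm_zero_iff by blast
  then have lim: "(\<lambda>k. Re ((map_matrix complex_of_real (matpow A k) *v ?x) $ i)) \<longlonglongrightarrow> 0" for i
    unfolding map_matrix_of_real_matpow
    by (metis tendsto_Re tendsto_vec_nth zero_complex.simps(1) zero_index)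
  have "Re ((map_matrix complex_of_real (matpow A k) *v ?x) $ i) = (matpow A k *v x) $ i" for k i
    by (simp add: matrix_vector_mult_def)
  with lim show ?thesis by (intro vec_tendstoI) auto
qed

section \<open>Lyapunov criterion for the spectral radius\<close>

lemma inner_transpose_matrix_vector: "x \<bullet> (transpose M *v y) = (M *v x) \<bullet> (y :: real^'n)"
  using dot_lmul_matrix[of y M x] by (simp add: inner_commute)

text \<open>Split a complex eigenvector as \<open>a + i b\<close>. The sum of the forms of
  \<open>P\<close> at \<open>a\<close> and \<open>b\<close> is multiplied by \<open>|c|^2\<close>
  under \<open>A\<close>, the cross terms cancelling by symmetry. Strict decrease then forces
  \<open>|c| < 1\<close>.\<close>

lemma spectral_radius_less_1_if_lyapunov_decrease:
  fixes A P :: "real^'n^'n"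
  assumes "transpose P = P" "\<And>x. 0 \<le> x \<bullet> (P *v x)"
    and "\<And>x. x \<noteq> 0 \<Longrightarrow> (A *v x) \<bullet> (P *v (A *v x)) < x \<bullet> (P *v x)"
  shows "spectral_radius A < 1"
  unfolding spectral_radius_less_iff
proof
  fix c assume "c \<in> mat_spectrum A"
  then obtain v where v: "v \<noteq> 0" "map_matrix complex_of_real A *v v = c *s v"
    by (auto simp: mat_spectrum_def)
  define a b where "a = (\<chi> i. Re (v $ i))" and "b = (\<chi> i. Im (v $ i))"
  have e: "(\<Sum>j\<in>UNIV. complex_of_real (A $ i $ j) * v $ j) = c * v $ i" for i
    using v(2) by (simp add: vec_eq_iff matrix_vector_mult_def)
  have Aa: "A *v a = Re c *\<^sub>R a - Im c *\<^sub>R b"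
    using arg_cong[OF e, of Re] by (simp add: vec_eq_iff matrix_vector_mult_def a_def b_def)
  have Ab: "A *v b = Im c *\<^sub>R a + Re c *\<^sub>R b"
    using arg_cong[OF e, of Im] by (simp add: vec_eq_iff matrix_vector_mult_def a_def b_def algebra_simps)
  define q where "q x = x \<bullet> (P *v x)" for x
  have sym: "b \<bullet> (P *v a) = a \<bullet> (P *v b)"
    using inner_transpose_matrix_vector[of a P b] assms(1) by (simp add: inner_commute)
  have "q (A *v a) + q (A *v b) = ((Re c)\<^sup>2 + (Im c)\<^sup>2) * (q a + q b)"
    unfolding q_def Aa Ab
    by (simp add: algebra_simps inner_add_left inner_add_right inner_diff_left inner_diff_right
        matrix_vector_mult_scaleR sym power2_eq_square)
  moreover have "q (A *v x) \<le> q x" "x \<noteq> 0 \<Longrightarrow> q (A *v x) < q x" for x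
    using assms(3)[of x] by (cases "x = 0"; simp add: q_def)+
  moreover have "a \<noteq> 0 \<or> b \<noteq> 0"
    using v(1) by (auto simp: vec_eq_iff a_def b_def complex_eq_iff)
  ultimately have "((Re c)\<^sup>2 + (Im c)\<^sup>2) * (q a + q b) < 1 * (q a + q b)"
    by (smt (verit))
  moreover have "q a + q b \<ge> 0" using assms(2) by (simp add: q_def)
  ultimately have "(Re c)\<^sup>2 + (Im c)\<^sup>2 < 1"
    using mult_right_mono[of 1 "(Re c)\<^sup>2 + (Im c)\<^sup>2" "q a + q b"] by linarith
  then show "cmod c < 1" by (simp add: cmod_def)
qed

section \<open>Positive semidefinite matrices and trace inequalities\<close>

definition psd :: "real^'n^'n \<Rightarrow> bool" where
  "psd M \<longleftrightarrow> transpose M = M \<and> (\<forall>x. 0 \<le> x \<bullet> (M *v x))"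

lemma psd_nonneg: "psd M \<Longrightarrow> 0 \<le> x \<bullet> (M *v x)"
  by (simp add: psd_def)

lemma psd_transpose: "psd M \<Longrightarrow> transpose M = M"
  by (simp add: psd_def)

lemma inner_symmetric_matrix:
  fixes M :: "real^'n^'n"
  shows "transpose M = M \<Longrightarrow> x \<bullet> (M *v y) = y \<bullet> (M *v x)"
  using inner_transpose_matrix_vector[of x M y] by (metis inner_commute)

lemma transpose_add: "transpose (M + N) = transpose M + transpose (N :: 'a::plus^'n^'m)"
  by (simp add: vec_eq_iff transpose_def)

lemma transpose_diff: "transpose (M - N) = transpose M - transpose (N :: 'a::minus^'n^'m)"
  by (simp add: vec_eq_iff transpose_def)

lemma mat_scaleR_mult_vec: "(c *\<^sub>R M) *v x = c *\<^sub>R (M *v (x :: real^'n))"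
  by (simp add: scaleR_matrix_vector_assoc)

lemma matrix_add_rdistrib: "(M + N) ** P = M ** P + N ** (P :: real^'k^'n)"
  by (simp add: vec_eq_iff matrix_matrix_mult_def sum.distrib distrib_right)

lemma matrix_mult_scaleR_right: "M ** (c *\<^sub>R N) = c *\<^sub>R (M ** (N :: real^'k^'n))"
  by (simp add: vec_eq_iff matrix_matrix_mult_def sum_distrib_left mult_ac)

lemma trace_scaleR: "trace (c *\<^sub>R (M :: real^'n^'n)) = c * trace M"
  by (simp add: trace_def sum_distrib_left)

text \<open>Moving from \<open>v\<close> against \<open>N v\<close> would make the form negative
  unless \<open>N v = 0\<close>.\<close>

lemma psd_vec_eq_0:
  assumes "psd N" "v \<bullet> (N *v v) = 0"
  shows "N *v v = 0"
proof -
  define y where "y = N *v v"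
  define b where "b = y \<bullet> (N *v y)"
  have "b \<ge> 0" using assms(1) by (simp add: b_def psd_nonneg)
  \<comment> \<open>The minimising step would be \<open>- (y \<bullet> y) / b\<close>; the
    denominator \<open>b + 1\<close> also covers \<open>b = 0\<close>.\<close>
  define t where "t = - (y \<bullet> y) / (b + 1)"
  have "0 \<le> (v + t *\<^sub>R y) \<bullet> (N *v (v + t *\<^sub>R y))" using assms(1) by (rule psd_nonneg)
  also have "\<dots> = 2 * t * (y \<bullet> y) + t\<^sup>2 * b"
    using assms(2) inner_symmetric_matrix[OF psd_transpose[OF assms(1)], of v y]
    by (simp add: matrix_vector_right_distrib matrix_vector_mult_scaleR inner_add_left
        inner_add_right b_def power2_eq_square algebra_simps flip: y_def)
  also have "\<dots> = - (y \<bullet> y)\<^sup>2 * (b + 2) / (b + 1)\<^sup>2"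
    using \<open>b \<ge> 0\<close> by (simp add: t_def divide_simps power2_eq_square) (simp add: algebra_simps)
  finally have "(y \<bullet> y)\<^sup>2 * (b + 2) / (b + 1)\<^sup>2 \<le> 0" by simp
  then have "(y \<bullet> y)\<^sup>2 \<le> 0" using \<open>b \<ge> 0\<close> by (auto simp: divide_le_0_iff mult_le_0_iff)
  then show ?thesis by (simp add: y_def)
qed

lemma trace_outer_product:
  fixes N :: "real^'n^'n"
  shows "trace (N ** (\<chi> i j. u $ i * u $ j)) = u \<bullet> (N *v u)"
  by (simp add: trace_def matrix_matrix_mult_def inner_vec_def matrix_vector_mult_def
      sum_distrib_left mult_ac)

lemma inner_axis_matrix_axis: "axis i 1 \<bullet> (M *v axis j 1) = (M :: real^'n^'n) $ i $ j"
  by (simp add: matrix_vector_mult_basis column_def inner_axis')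

text \<open>Symmetric elimination peels rank-one terms off \<open>S\<close>, so no spectral theorem is needed.\<close>

lemma trace_psd_nonneg:
  assumes "psd S" and N: "\<And>x. 0 \<le> x \<bullet> (N *v x)"
  shows "0 \<le> trace (N ** S)"
  using assms(1)
proof (induction "card {i. S $ i $ i \<noteq> 0}" arbitrary: S rule: less_induct)
  case less
  note sym = psd_transpose[OF less.prems]
  have diag: "S $ i $ i \<ge> 0" for i
    using psd_nonneg[OF less.prems, of "axis i 1"] by (simp add: inner_axis_matrix_axis)
  show ?case
  proof (cases "\<exists>i. S $ i $ i \<noteq> 0")
    case False
    then have "S *v axis i 1 = 0" for i
      using psd_vec_eq_0[OF less.prems, of "axis i 1"] by (simp add: inner_axis_matrix_axis)
    then have "S = 0"
      by (metis inner_axis_matrix_axis inner_zero_right vec_eq_iff zero_index)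
    then show ?thesis by (simp add: trace_def)
  next
    case True
    then obtain i where i: "S $ i $ i \<noteq> 0" by blast
    define d u where "d = S $ i $ i" and "u = S *v axis i 1"
    have d: "d > 0" using i diag[of i] by (simp add: d_def)
    \<comment> \<open>The Schur complement at position \<open>i\<close>: it clears that diagonal
      entry and creates no new nonzero one, so the induction measure drops.\<close>
    define S' where "S' = S - (1 / d) *\<^sub>R (\<chi> j k. u $ j * u $ k)"
    have S'v: "x \<bullet> (S' *v x) = x \<bullet> (S *v x) - (u \<bullet> x)\<^sup>2 / d" for x
    proof -
      have "(\<chi> j k. u $ j * u $ k) *v x = (u \<bullet> x) *\<^sub>R u"
        by (simp add: vec_eq_iff matrix_vector_mult_def inner_vec_def sum_distrib_left sum_distrib_right mult_ac)
      then show ?thesis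
        by (simp add: S'_def matrix_vector_mult_diff_rdistrib mat_scaleR_mult_vec inner_diff_right
            power2_eq_square inner_commute)
    qed
    have "psd S'"
      unfolding psd_def
    proof
      have "transpose (\<chi> j k. u $ j * u $ k) = (\<chi> j k. u $ j * u $ k)"
        by (simp add: vec_eq_iff transpose_def mult.commute)
      then show "transpose S' = S'" by (simp add: S'_def transpose_diff sym transpose_scalar)
      show "\<forall>x. 0 \<le> x \<bullet> (S' *v x)"
      proof
        fix x
        \<comment> \<open>This \<open>t\<close> minimises the form of \<open>S\<close> along
          \<open>x - t e_i\<close>, and the minimum is the form of \<open>S'\<close> at
          \<open>x\<close>.\<close>
        define t where "t = (u \<bullet> x) / d"
        have "axis i 1 \<bullet> (S *v x) = u \<bullet> x" "axis i 1 \<bullet> u = d"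
          using inner_symmetric_matrix[OF sym, of "axis i 1" x] inner_axis_matrix_axis[of i S i]
          by (simp_all add: u_def inner_commute d_def)
        then have "(x - t *\<^sub>R axis i 1) \<bullet> (S *v (x - t *\<^sub>R axis i 1)) = x \<bullet> (S *v x) - 2 * t * (u \<bullet> x) + t\<^sup>2 * d"
          by (simp add: matrix_vector_mult_diff_distrib matrix_vector_mult_scaleR inner_diff_left
              inner_diff_right power2_eq_square inner_commute flip: u_def)
        also have "\<dots> = x \<bullet> (S' *v x)"
          using d by (simp add: S'v t_def field_simps power2_eq_square)
        finally show "0 \<le> x \<bullet> (S' *v x)" using psd_nonneg[OF less.prems] by metis
      qed
    qed
    have S'diag: "S' $ j $ j = S $ j $ j - (u $ j)\<^sup>2 / d" for j
      by (simp add: S'_def power2_eq_square)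
    have "{j. S' $ j $ j \<noteq> 0} \<subset> {j. S $ j $ j \<noteq> 0}"
    proof
      show "{j. S' $ j $ j \<noteq> 0} \<subseteq> {j. S $ j $ j \<noteq> 0}"
      proof clarify
        fix j assume j: "S' $ j $ j \<noteq> 0" "S $ j $ j = 0"
        have "S' $ j $ j \<ge> 0"
          using psd_nonneg[OF \<open>psd S'\<close>, of "axis j 1"] by (simp add: inner_axis_matrix_axis)
        moreover have "(u $ j)\<^sup>2 / d \<ge> 0" using d by simp
        ultimately show False using S'diag[of j] j by simp
      qed
      have "u $ i = d" by (simp add: u_def d_def matrix_vector_mult_basis column_def)
      then have "S' $ i $ i = 0" using d by (simp add: S'diag power2_eq_square) (simp add: d_def)
      then show "{j. S' $ j $ j \<noteq> 0} \<noteq> {j. S $ j $ j \<noteq> 0}" using i by blast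
    qed
    then have "card {j. S' $ j $ j \<noteq> 0} < card {j. S $ j $ j \<noteq> 0}"
      by (intro psubset_card_mono) auto
    from less.hyps[OF this \<open>psd S'\<close>] have "0 \<le> trace (N ** S')" .
    moreover have "trace (N ** S) = trace (N ** S') + (u \<bullet> (N *v u)) / d"
    proof -
      have "N ** S = N ** S' + (1 / d) *\<^sub>R (N ** (\<chi> j k. u $ j * u $ k))"
        unfolding matrix_mult_scaleR_right[symmetric] matrix_add_ldistrib[symmetric] by (simp add: S'_def)
      then show ?thesis by (simp add: trace_add trace_scaleR trace_outer_product)
    qed
    ultimately show ?thesis using d N[of u] by simp
  qed
qed

lemma trace_psd_mono:
  assumes "psd S" and "\<And>x. x \<bullet> (N *v x) \<le> x \<bullet> (N' *v x)"
  shows "trace (N ** S) \<le> trace (N' ** S)"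
proof -
  have "0 \<le> trace ((N' - N) ** S)"
    by (rule trace_psd_nonneg) (use assms in \<open>simp_all add: matrix_vector_mult_diff_rdistrib inner_diff_right\<close>)
  moreover have "(N' - N) ** S + N ** S = N' ** S"
    by (simp flip: matrix_add_rdistrib)
  ultimately show ?thesis by (metis add.commute le_add_same_cancel1 trace_add)
qed

lemma trace_psd_le_scaled:
  assumes "psd S" and "\<And>x. x \<bullet> (N *v x) \<le> c * (x \<bullet> x)"
  shows "trace (N ** S) \<le> c * trace S"
  using trace_psd_mono[OF assms(1), of N "c *\<^sub>R mat 1"] assms(2)
  by (simp add: mat_scaleR_mult_vec trace_scaleR flip: scalar_matrix_assoc)

lemma trace_psd_ge_scaled:
  assumes "psd S" and "\<And>x. c * (x \<bullet> x) \<le> x \<bullet> (N *v x)"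
  shows "c * trace S \<le> trace (N ** S)"
  using trace_psd_mono[OF assms(1), of "c *\<^sub>R mat 1" N] assms(2)
  by (simp add: mat_scaleR_mult_vec trace_scaleR flip: scalar_matrix_assoc)

lemma psd_trace_nonneg: "psd S \<Longrightarrow> 0 \<le> trace S"
  using trace_psd_nonneg[of S "mat 1"] by simp

text \<open>By Cauchy-Schwarz the rank-one matrix \<open>x x^T\<close> is at most
  \<open>x \<bullet> x\<close> times the identity; pairing it with \<open>S\<close> gives the
  bound.\<close>

lemma psd_le_trace:
  assumes "psd S"
  shows "x \<bullet> (S *v x) \<le> trace S * (x \<bullet> x)"
proof -
  have "y \<bullet> ((\<chi> i j. x $ i * x $ j) *v y) \<le> (x \<bullet> x) * (y \<bullet> y)" for y
  proof -
    have "(\<chi> i j. x $ i * x $ j) *v y = (x \<bullet> y) *\<^sub>R x"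
      by (simp add: vec_eq_iff matrix_vector_mult_def inner_vec_def sum_distrib_left sum_distrib_right mult_ac)
    then show ?thesis
      using Cauchy_Schwarz_ineq[of x y] by (simp add: power2_eq_square inner_commute)
  qed
  from trace_psd_le_scaled[OF assms this] show ?thesis
    by (subst (asm) trace_mul_sym) (simp add: trace_outer_product mult.commute)
qed

lemma trace_transpose_mult_self: "trace (transpose E ** E) = (norm (E :: real^'m^'n))\<^sup>2"
  unfolding power2_norm_eq_inner
  by (simp add: trace_def matrix_matrix_mult_def transpose_def inner_vec_def)
    (subst sum.swap, simp)

lemma norm_matrix_vector_mult_le: "norm (M *v x) \<le> norm M * norm (x :: real^'n)"
proof -
  have "norm (M *v x) \<le> L2_set (\<lambda>i. norm (M $ i) * norm x) UNIV"
    unfolding norm_vec_def[of "M *v x"]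
    by (rule L2_set_mono) (simp_all add: matrix_vector_mul_component Cauchy_Schwarz_ineq2)
  also have "\<dots> = norm M * norm x"
    by (simp add: norm_vec_def[of M] L2_set_left_distrib)
  finally show ?thesis .
qed

section \<open>The smallest singular value\<close>

text \<open>Minimise the form on the compact unit sphere. With minimum \<open>r\<close> at
  \<open>v\<close>, the matrix \<open>M - r I\<close> is positive semidefinite with vanishing form
  at \<open>v\<close>, so \<open>v\<close> is an eigenvector for \<open>r\<close>.\<close>

lemma sym_pos_def_attains_sigma:
  assumes "sym_pos_def M"
  obtains r where "r \<in> singular_values M" "\<And>x. r * (x \<bullet> x) \<le> x \<bullet> (M *v x)"
proof -
  let ?q = "\<lambda>x. x \<bullet> (M *v x)"
  have "continuous_on (sphere 0 1) ?q"
    by (intro continuous_intros)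
  moreover have "sphere 0 1 \<noteq> ({} :: (real^'a) set)" by simp
  ultimately obtain v where v: "norm v = 1" "\<And>x. norm x = 1 \<Longrightarrow> ?q v \<le> ?q x"
    using continuous_attains_inf[of "sphere 0 1" ?q] by auto
  define r where "r = ?q v"
  have vv: "v \<bullet> v = 1" using v(1) by (simp add: norm_eq_1)
  then have "v \<noteq> 0" by auto
  have ge: "r * (x \<bullet> x) \<le> ?q x" for x
  proof (cases "x = 0")
    case False
    define y where "y = (1 / norm x) *\<^sub>R x"
    have "norm y = 1" "x = norm x *\<^sub>R y" using False by (simp_all add: y_def)
    then have "?q x = (norm x)\<^sup>2 * ?q y"
      by (metis (no_types, lifting) inner_scaleR_left inner_scaleR_right matrix_vector_mult_scaleR
          mult.assoc power2_eq_square)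
    with v(2)[OF \<open>norm y = 1\<close>] show ?thesis
      by (simp add: r_def power2_norm_eq_inner mult.commute mult_left_mono)
  qed simp
  have "psd (M - r *\<^sub>R mat 1)"
    using assms ge
    by (simp add: psd_def sym_pos_def_def transpose_diff transpose_scalar matrix_vector_mult_diff_rdistrib
        inner_diff_right mat_scaleR_mult_vec)
  from psd_vec_eq_0[OF this, of v] have Mv: "M *v v = r *\<^sub>R v"
    by (simp add: matrix_vector_mult_diff_rdistrib inner_diff_right mat_scaleR_mult_vec vv r_def)
  have "r \<ge> 0" using assms \<open>v \<noteq> 0\<close> by (auto simp: r_def sym_pos_def_def intro: less_imp_le)
  moreover have "(transpose M ** M) *v v = r\<^sup>2 *s v"
    using assms by (simp add: sym_pos_def_def Mv matrix_vector_mult_scaleR scalar_mult_eq_scaleR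
        power2_eq_square flip: matrix_vector_mul_assoc)
  ultimately have "r \<in> singular_values M" using \<open>v \<noteq> 0\<close> by (auto simp: singular_values_def)
  with ge that show ?thesis by blast
qed

text \<open>Squares of singular values are eigenvalues of \<open>M^T M\<close>, and squaring is
  injective on nonnegative numbers.\<close>

lemma finite_singular_values: "finite (singular_values M)"
proof -
  let ?f = "\<lambda>s. complex_of_real (s\<^sup>2)"
  have "?f ` singular_values M \<subseteq> mat_spectrum (transpose M ** M)"
  proof clarify
    fix s assume "s \<in> singular_values M"
    then obtain v where v: "v \<noteq> 0" "(transpose M ** M) *v v = s\<^sup>2 *s v"
      by (auto simp: singular_values_def)
    let ?v = "\<chi> i. complex_of_real (v $ i)"
    have "?v \<noteq> 0" using v(1) by (simp add: vec_eq_iff)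
    moreover have "map_matrix complex_of_real (transpose M ** M) *v ?v = ?f s *s ?v"
    proof -
      have "(\<Sum>j\<in>UNIV. (transpose M ** M) $ i $ j * v $ j) = s\<^sup>2 * v $ i" for i
        using v(2) by (simp add: vec_eq_iff matrix_vector_mult_def)
      then show ?thesis
        by (simp add: vec_eq_iff matrix_vector_mult_def flip: of_real_mult of_real_sum of_real_power)
    qed
    ultimately show "?f s \<in> mat_spectrum (transpose M ** M)"
      by (auto simp: mat_spectrum_def)
  qed
  then have "finite (?f ` singular_values M)" using finite_mat_spectrum finite_subset by blast
  moreover have "inj_on ?f (singular_values M)"
    by (auto simp: inj_on_def singular_values_def of_real_eq_iff power2_eq_iff_nonneg
        simp del: of_real_power)
  ultimately show ?thesis by (rule finite_imageD)
qed

text \<open>A singular value \<open>0\<close> would give \<open>M (M v) = 0\<close> with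
  \<open>v\<close> nonzero, which definiteness excludes. The bound holds because the minimum is at
  most the singular value \<open>r\<close> that already bounds the form from below.\<close>

lemma sigma_min_sym_pos_def:
  assumes "sym_pos_def M"
  shows "sigma_min M > 0" and "sigma_min M * (x \<bullet> x) \<le> x \<bullet> (M *v x)"
proof -
  obtain r where r: "r \<in> singular_values M" "\<And>x. r * (x \<bullet> x) \<le> x \<bullet> (M *v x)"
    using sym_pos_def_attains_sigma[OF assms] by blast
  have "s > 0" if "s \<in> singular_values M" for s
  proof (rule ccontr)
    assume "\<not> s > 0"
    with that have "s = 0" by (simp add: singular_values_def)
    from that obtain v where "v \<noteq> 0" "(transpose M ** M) *v v = s\<^sup>2 *s v"
      unfolding singular_values_def by blast
    then have v: "v \<noteq> 0" "(transpose M ** M) *v v = 0" using \<open>s = 0\<close> by simp_all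
    have "M *v (M *v v) = 0"
      using v(2) assms unfolding sym_pos_def_def by (simp only: matrix_vector_mul_assoc)
    moreover have "w = 0" if "M *v w = 0" for w
    proof (rule ccontr)
      assume "w \<noteq> 0"
      with assms have "w \<bullet> (M *v w) > 0" unfolding sym_pos_def_def by blast
      with that show False by simp
    qed
    ultimately show False using v(1) by blast
  qed
  moreover have "sigma_min M \<in> singular_values M"
    unfolding sigma_min_def using r(1) by (intro Min_in finite_singular_values) auto
  ultimately show "sigma_min M > 0" by blast
  have "sigma_min M \<le> r"
    unfolding sigma_min_def using r(1) by (intro Min_le finite_singular_values)
  then show "sigma_min M * (x \<bullet> x) \<le> x \<bullet> (M *v x)"
    using r(2)[of x] mult_right_mono[of "sigma_min M" r "x \<bullet> x"] by simp
qed

lemma sym_pos_def_psd: "sym_pos_def M \<Longrightarrow> psd M"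
  unfolding sym_pos_def_def psd_def by (metis inner_zero_left less_imp_le order_refl)

lemma norm_matrix_vector_le_op_norm: "norm (M *v x) \<le> op_norm M * norm x"
  unfolding op_norm_def by (rule onorm) simp

lemma quadratic_form_le_op_norm: "x \<bullet> (M *v x) \<le> op_norm M * (x \<bullet> x)"
proof -
  have "x \<bullet> (M *v x) \<le> norm x * norm (M *v x)" by (rule norm_cauchy_schwarz)
  also have "\<dots> \<le> norm x * (op_norm M * norm x)"
    by (intro mult_left_mono norm_matrix_vector_le_op_norm) simp
  finally show ?thesis by (simp add: power2_norm_eq_inner[symmetric] power2_eq_square mult_ac)
qed

lemma sigma_min_le_op_norm:
  assumes "sym_pos_def M"
  shows "sigma_min M \<le> op_norm M"
proof -
  obtain x :: "real^'a" where "norm x = 1" using vector_choose_size[of 1] by auto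
  then have "x \<bullet> x = 1" by (simp add: norm_eq_1)
  with sigma_min_sym_pos_def(2)[OF assms, of x] quadratic_form_le_op_norm[of x M] show ?thesis
    by simp
qed

section \<open>Discrete Lyapunov equations\<close>

lemma matpow_commute: "matpow M k ** M = M ** matpow M k"
  by (induction k) (simp_all flip: matrix_mul_assoc)

lemma transpose_matpow: "transpose (matpow M k) = matpow (transpose (M :: real^'n^'n)) k"
  by (induction k) (simp_all add: matrix_transpose_mul matpow_commute)

text \<open>Coordinates of the transposed orbit are inner products of \<open>x\<close> with orbits
  of basis vectors under \<open>M\<close>, so the covariance equation needs no spectral argument of
  its own.\<close>

lemma matpow_transpose_tendsto_0:
  fixes M :: "real^'n^'n"
  assumes "\<And>x. (\<lambda>k. matpow M k *v x) \<longlonglongrightarrow> 0"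
  shows "(\<lambda>k. matpow (transpose M) k *v x) \<longlonglongrightarrow> 0"
proof (rule vec_tendstoI)
  fix i
  have "(matpow (transpose M) k *v x) $ i = (matpow M k *v axis i 1) \<bullet> x" for k
    using inner_transpose_matrix_vector[of "axis i 1" "matpow M k" x] by (simp only: transpose_matpow inner_axis') simp
  then show "(\<lambda>k. (matpow (transpose M) k *v x) $ i) \<longlonglongrightarrow> 0 $ i"
    using tendsto_inner[OF assms tendsto_const, of "axis i 1" x] by simp
qed

lemma lyapunov_form:
  fixes M P W :: "real^'n^'n"
  assumes "P = W + transpose M ** P ** M"
  shows "x \<bullet> (P *v y) = x \<bullet> (W *v y) + (M *v x) \<bullet> (P *v (M *v y))"
proof -
  have "P *v y = W *v y + transpose M *v (P *v (M *v y))"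
    by (subst assms) (simp only: matrix_vector_mult_add_rdistrib matrix_vector_mul_assoc matrix_mul_assoc)
  then show ?thesis by (simp only: inner_add_right inner_transpose_matrix_vector)
qed

text \<open>An element of the kernel of \<open>P \<mapsto> P - M^T P M\<close> has a bilinear form
  unchanged along orbits, which tend to \<open>0\<close>, so it vanishes. In finite dimension this
  injectivity gives surjectivity too.\<close>

lemma lyapunov_ex1:
  fixes M W :: "real^'n^'n"
  assumes "\<And>x. (\<lambda>k. matpow M k *v x) \<longlonglongrightarrow> 0"
  shows "\<exists>!P. P = W + transpose M ** P ** M"
proof -
  let ?L = "\<lambda>P. P - transpose M ** P ** M"
  have lin: "linear ?L"
    by (rule linearI) (simp_all add: matrix_add_ldistrib matrix_add_rdistrib matrix_mult_scaleR_right
        scalar_matrix_assoc scaleR_diff_right flip: matrix_mul_assoc)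
  have "P = 0" if "?L P = 0" for P
  proof -
    have P: "P = 0 + transpose M ** P ** M" using that by simp
    have *: "x \<bullet> (P *v y) = (matpow M k *v x) \<bullet> (P *v (matpow M k *v y))" for x y k
    proof (induction k)
      case (Suc k)
      then show ?case
        using lyapunov_form[OF P, of "matpow M k *v x" "matpow M k *v y"]
        by (simp add: matrix_vector_mul_assoc)
    qed simp
    have "(\<lambda>k. (matpow M k *v x) \<bullet> (P *v (matpow M k *v y))) \<longlonglongrightarrow> 0 \<bullet> (P *v 0)" for x y
      by (intro tendsto_inner assms bounded_linear.tendsto[OF matrix_vector_mul_bounded_linear])
    then have "x \<bullet> (P *v y) = 0" for x y
      unfolding *[symmetric] by (simp add: LIMSEQ_const_iff)
    then show ?thesis by (metis inner_axis_matrix_axis vec_eq_iff zero_index)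
  qed
  then have inj: "inj ?L" using linear_injective_0[OF lin] by blast
  then have "surj ?L" by (rule linear_inj_imp_surj[OF lin])
  from surjD[OF this, of W] obtain P where "W = ?L P" ..
  then have "\<exists>P. P = W + transpose M ** P ** M" by (intro exI[of _ P]) simp
  moreover have "P = P'" if "P = W + transpose M ** P ** M" "P' = W + transpose M ** P' ** M" for P P'
    proof (rule injD[OF inj])
    have "?L P = W" "?L P' = W" using that by (metis add_diff_cancel)+
    then show "?L P = ?L P'" by simp
  qed
  ultimately show ?thesis by blast
qed

text \<open>The transpose of \<open>P\<close> solves the same equation, so uniqueness gives
  symmetry. The form of \<open>P\<close> does not increase along an orbit and tends to
  \<open>0\<close>, so it is nonnegative at the start.\<close>

lemma lyapunov_solution:
  fixes M P W :: "real^'n^'n"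
  assumes lim: "\<And>x. (\<lambda>k. matpow M k *v x) \<longlonglongrightarrow> 0"
    and P: "P = W + transpose M ** P ** M" and W: "psd W"
  shows "psd P" and "x \<bullet> (W *v x) \<le> x \<bullet> (P *v x)"
proof -
  have "transpose P = transpose (W + transpose M ** P ** M)" by (rule arg_cong[OF P])
  also have "\<dots> = W + transpose M ** transpose P ** M"
    by (simp only: transpose_add matrix_transpose_mul transpose_transpose psd_transpose[OF W] matrix_mul_assoc)
  finally have sym: "transpose P = P" using lyapunov_ex1[OF lim] P by blast
  have nn: "0 \<le> x \<bullet> (P *v x)" for x
  proof -
    have "(matpow M k *v x) \<bullet> (P *v (matpow M k *v x)) \<le> x \<bullet> (P *v x)" for k
    proof (induction k)
      case (Suc k)
      then show ?case
        using lyapunov_form[OF P, of "matpow M k *v x" "matpow M k *v x"] psd_nonneg[OF W, of "matpow M k *v x"]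
        by (simp add: matrix_vector_mul_assoc)
    qed simp
    moreover have "(\<lambda>k. (matpow M k *v x) \<bullet> (P *v (matpow M k *v x))) \<longlonglongrightarrow> 0 \<bullet> (P *v 0)"
      by (intro tendsto_inner lim bounded_linear.tendsto[OF matrix_vector_mul_bounded_linear])
    ultimately show ?thesis by (intro LIMSEQ_le_const2[of _ 0]) auto
  qed
  with sym show "psd P" by (simp add: psd_def)
  show "x \<bullet> (W *v x) \<le> x \<bullet> (P *v x)" using lyapunov_form[OF P, of x x] nn[of "M *v x"] by simp
qed

text \<open>Expand \<open>trace (P ** S)\<close> once with each equation; by cyclicity of the trace
  the remaining terms agree.\<close>

lemma lyapunov_duality:
  fixes M P W :: "real^'n^'n"
  assumes P: "P = W + transpose M ** P ** M" and S: "S = V + M ** S ** transpose M"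
  shows "trace (W ** S) = trace (P ** V)"
proof -
  have "trace (P ** S) = trace (W ** S) + trace (transpose M ** P ** M ** S)"
    by (subst P) (simp add: matrix_add_rdistrib trace_add)
  moreover have "trace (P ** S) = trace (P ** V) + trace (P ** (M ** S ** transpose M))"
    by (subst S) (simp add: matrix_add_ldistrib trace_add)
  moreover have "trace (transpose M ** P ** M ** S) = trace (P ** (M ** S ** transpose M))"
    using trace_mul_sym[of "transpose M" "P ** M ** S"] by (simp add: matrix_mul_assoc)
  ultimately show ?thesis by simp
qed

section \<open>The linear-quadratic regulator\<close>

locale lqr =
  fixes A :: "real^'n^'n" and B :: "real^'m^'n"
    and Q :: "real^'n^'n" and R :: "real^'m^'m" and \<Psi> :: "real^'n^'n" and \<sigma> :: real
  assumes Q: "sym_pos_def Q" and R: "sym_pos_def R" and \<Psi>: "sym_pos_def \<Psi>"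
begin

abbreviation "closed_loop K \<equiv> A - B ** K"
abbreviation "noise \<equiv> \<Psi> + \<sigma>\<^sup>2 *\<^sub>R (B ** transpose B)"
abbreviation "weight K \<equiv> Q + transpose K ** R ** K"
abbreviation "cov K \<equiv> state_cov A B \<Psi> \<sigma> K"
abbreviation "val K \<equiv> value_matrix A B Q R K"
abbreviation "grad K \<equiv> natural_gradient A B Q R K"

text \<open>The real-valued counterpart of \<open>lqr_cost\<close>; the two agree on stabilizing
  gains.\<close>

definition cost :: "real^'n^'m \<Rightarrow> real" where
  "cost K = trace (weight K ** cov K) + trace (\<sigma>\<^sup>2 *\<^sub>R R)"

text \<open>The residual of \<open>val K\<close> in the Lyapunov equation of \<open>K'\<close>. At
  \<open>x\<close> its form is the extra noise-free cost of using \<open>K'\<close> for one step and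
  \<open>K\<close> afterwards, compared with \<open>K\<close> throughout.\<close>

definition bellman_defect :: "real^'n^'m \<Rightarrow> real^'n^'m \<Rightarrow> real^'n^'n" where
  "bellman_defect K K' = weight K' + transpose (closed_loop K') ** val K ** closed_loop K' - val K"

text \<open>By construction \<open>val K\<close> solves the Lyapunov equation of \<open>K'\<close>
  with weight \<open>weight K' - bellman_defect K K'\<close>. The same reading drives
  \<open>cost_difference\<close>.\<close>

lemma bellman_defect_split:
  "x \<bullet> (bellman_defect K K' *v x)
    = x \<bullet> (weight K' *v x) + (closed_loop K' *v x) \<bullet> (val K *v (closed_loop K' *v x)) - x \<bullet> (val K *v x)"
proof -
  have "val K = (weight K' - bellman_defect K K') + transpose (closed_loop K') ** val K ** closed_loop K'"
    by (simp add: bellman_defect_def)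
  from lyapunov_form[OF this, of x x] show ?thesis
    by (simp only: matrix_vector_mult_diff_rdistrib inner_diff_right)
qed

lemma weight_form: "x \<bullet> (weight K *v x) = x \<bullet> (Q *v x) + (K *v x) \<bullet> (R *v (K *v x))"
proof -
  have "weight K *v x = Q *v x + transpose K *v (R *v (K *v x))"
    by (simp only: matrix_vector_mult_add_rdistrib matrix_vector_mul_assoc matrix_mul_assoc)
  then show ?thesis by (simp only: inner_add_right inner_transpose_matrix_vector)
qed

lemma noise_form: "x \<bullet> (noise *v x) = x \<bullet> (\<Psi> *v x) + \<sigma>\<^sup>2 * ((transpose B *v x) \<bullet> (transpose B *v x))"
proof -
  have "noise *v x = \<Psi> *v x + \<sigma>\<^sup>2 *\<^sub>R (B *v (transpose B *v x))"
    by (simp only: matrix_vector_mult_add_rdistrib matrix_vector_mul_assoc mat_scaleR_mult_vec)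
  then show ?thesis
    using inner_transpose_matrix_vector[of x "transpose B" "transpose B *v x"]
    by (simp only: inner_add_right inner_scaleR_right transpose_transpose)
qed

lemma weight_ge: "x \<bullet> (Q *v x) \<le> x \<bullet> (weight K *v x)"
  unfolding weight_form using psd_nonneg[OF sym_pos_def_psd[OF R]] by simp

lemma psd_weight: "psd (weight K)"
proof -
  have "transpose (weight K) = weight K"
    using Q R by (simp only: sym_pos_def_def transpose_add matrix_transpose_mul transpose_transpose matrix_mul_assoc)
  then show ?thesis
    using weight_ge psd_nonneg[OF sym_pos_def_psd[OF Q]] unfolding psd_def by (meson order_trans)
qed

lemma noise_ge: "x \<bullet> (\<Psi> *v x) \<le> x \<bullet> (noise *v x)"
  unfolding noise_form by simp

lemma psd_noise: "psd noise"
proof -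
  have "transpose noise = noise"
    using \<Psi> by (simp only: sym_pos_def_def transpose_add matrix_transpose_mul transpose_transpose transpose_scalar)
  then show ?thesis
    using noise_ge psd_nonneg[OF sym_pos_def_psd[OF \<Psi>]] unfolding psd_def by (meson order_trans)
qed

section \<open>Cost and Bellman defect at a stabilizing gain\<close>

context
  fixes K :: "real^'n^'m"
  assumes K: "K \<in> stabilizing A B"
begin

lemma closed_loop_tendsto_0: "(\<lambda>k. matpow (closed_loop K) k *v x) \<longlonglongrightarrow> 0"
  using K by (intro spectral_radius_less_1_tendsto_0) (simp add: stabilizing_def)

lemma val_eq: "val K = weight K + transpose (closed_loop K) ** val K ** closed_loop K"
  unfolding value_matrix_def by (rule theI'[OF lyapunov_ex1[OF closed_loop_tendsto_0]])

lemma cov_eq: "cov K = noise + closed_loop K ** cov K ** transpose (closed_loop K)"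
  unfolding state_cov_def
  using theI'[OF lyapunov_ex1[OF matpow_transpose_tendsto_0[OF closed_loop_tendsto_0]], of noise]
  by (simp only: transpose_transpose)

lemma psd_val: "psd (val K)"
  by (rule lyapunov_solution(1)[OF closed_loop_tendsto_0 val_eq psd_weight])

lemma cov_eq_transpose:
  "cov K = noise + transpose (transpose (closed_loop K)) ** cov K ** transpose (closed_loop K)"
  using cov_eq by (simp only: transpose_transpose)

lemma psd_cov: "psd (cov K)"
  by (rule lyapunov_solution(1)[OF matpow_transpose_tendsto_0[OF closed_loop_tendsto_0]
        cov_eq_transpose psd_noise])

lemma cov_ge: "sigma_min \<Psi> * (x \<bullet> x) \<le> x \<bullet> (cov K *v x)"
  using lyapunov_solution(2)[OF matpow_transpose_tendsto_0[OF closed_loop_tendsto_0]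
      cov_eq_transpose psd_noise, of x] noise_ge[of x] sigma_min_sym_pos_def(2)[OF \<Psi>, of x]
  by linarith

lemma cost_eq_val: "cost K = trace (val K ** noise) + trace (\<sigma>\<^sup>2 *\<^sub>R R)"
  using lyapunov_duality[OF val_eq cov_eq] by (simp add: cost_def)

lemma trace_noise_nonneg: "0 \<le> trace (\<sigma>\<^sup>2 *\<^sub>R R)"
  using psd_trace_nonneg[OF sym_pos_def_psd[OF R]] by (simp add: trace_scaleR)

lemma trace_cov_le: "sigma_min Q * trace (cov K) \<le> cost K"
proof -
  have "sigma_min Q * trace (cov K) \<le> trace (weight K ** cov K)"
    by (rule trace_psd_ge_scaled[OF psd_cov])
      (meson order_trans weight_ge sigma_min_sym_pos_def(2)[OF Q])
  then show ?thesis using trace_noise_nonneg by (simp add: cost_def)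
qed

lemma trace_val_le: "sigma_min \<Psi> * trace (val K) \<le> cost K"
proof -
  have "sigma_min \<Psi> * trace (val K) \<le> trace (noise ** val K)"
    by (rule trace_psd_ge_scaled[OF psd_val])
      (meson order_trans noise_ge sigma_min_sym_pos_def(2)[OF \<Psi>])
  then show ?thesis using trace_noise_nonneg by (simp add: cost_eq_val trace_mul_sym[of noise])
qed

lemma psd_cov_minus: "psd (cov K - sigma_min \<Psi> *\<^sub>R mat 1)"
  using psd_transpose[OF psd_cov] cov_ge
  by (simp add: psd_def transpose_diff transpose_scalar matrix_vector_mult_diff_rdistrib
      inner_diff_right mat_scaleR_mult_vec)

text \<open>The covariance dominates \<open>sigma_min \<Psi>\<close> times the identity, whose trace
  is at least \<open>sigma_min \<Psi>\<close>. This makes the optimal cost positive and later gives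
  \<open>\<theta> \<le> 1 / 2\<close>.\<close>

lemma cost_ge: "sigma_min Q * sigma_min \<Psi> \<le> cost K"
proof -
  have "0 \<le> trace (cov K - sigma_min \<Psi> *\<^sub>R mat 1)" by (rule psd_trace_nonneg[OF psd_cov_minus])
  then have "sigma_min \<Psi> * CARD('n) \<le> trace (cov K)"
    by (simp add: trace_sub trace_scaleR trace_I)
  moreover have "sigma_min \<Psi> * 1 \<le> sigma_min \<Psi> * CARD('n)"
    using sigma_min_sym_pos_def(1)[OF \<Psi>] by (intro mult_left_mono) auto
  ultimately have "sigma_min Q * sigma_min \<Psi> \<le> sigma_min Q * trace (cov K)"
    using sigma_min_sym_pos_def(1)[OF Q] by (intro mult_left_mono) auto
  with trace_cov_le show ?thesis by linarith
qed

text \<open>Expanding around \<open>K\<close>, the terms free of \<open>y\<close> cancel by the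
  equation of \<open>val K\<close>. The linear part is the natural gradient, and the quadratic part
  has Hessian \<open>R + B^T P B\<close>.\<close>

lemma bellman_defect_form:
  fixes K' :: "real^'n^'m" and x
  defines "y \<equiv> (K' - K) *v x"
  shows "x \<bullet> (bellman_defect K K' *v x)
    = y \<bullet> (R *v y) + (B *v y) \<bullet> (val K *v (B *v y)) + 2 * (y \<bullet> (grad K *v x))"
proof -
  define u w where "u = K *v x" and "w = closed_loop K *v x"
  have K'x: "K' *v x = u + y"
    by (simp add: y_def u_def matrix_vector_mult_diff_rdistrib)
  have w: "w = A *v x - B *v u"
    by (simp add: w_def u_def matrix_vector_mult_diff_rdistrib matrix_vector_mul_assoc)
  have M'x: "closed_loop K' *v x = w - B *v y"
    by (simp add: w matrix_vector_mult_diff_rdistrib K'x matrix_vector_right_distrib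
        flip: matrix_vector_mul_assoc)
  have "grad K *v x = R *v u + transpose B *v (val K *v (B *v u)) - transpose B *v (val K *v (A *v x))"
    unfolding natural_gradient_def u_def
    by (simp only: matrix_vector_mult_add_rdistrib matrix_vector_mult_diff_rdistrib
        matrix_vector_mul_assoc matrix_mul_assoc matrix_add_rdistrib)
  also have "\<dots> = R *v u - transpose B *v (val K *v w)"
    unfolding w by (simp only: matrix_vector_mult_diff_distrib) simp
  finally have g: "y \<bullet> (grad K *v x) = y \<bullet> (R *v u) - (B *v y) \<bullet> (val K *v w)"
    by (simp only: inner_diff_right inner_transpose_matrix_vector)
  have D: "x \<bullet> (bellman_defect K K' *v x)
      = x \<bullet> (weight K' *v x) + (w - B *v y) \<bullet> (val K *v (w - B *v y)) - x \<bullet> (val K *v x)"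
    by (simp only: bellman_defect_split M'x)
  have v: "x \<bullet> (val K *v x) = x \<bullet> (weight K *v x) + w \<bullet> (val K *v w)"
    using lyapunov_form[OF val_eq, of x x] by (simp only: w_def)
  show ?thesis
    unfolding D v g weight_form K'x u_def[symmetric]
    using inner_symmetric_matrix[OF psd_transpose[OF psd_val], of w "B *v y"]
      inner_symmetric_matrix[OF psd_transpose[OF sym_pos_def_psd[OF R]], of u y]
    by (simp add: matrix_vector_right_distrib matrix_vector_mult_diff_distrib inner_add_left
        inner_add_right inner_diff_left inner_diff_right)
qed

text \<open>The performance difference lemma: duality pairs \<open>val K\<close>, with its reduced
  weight, against the covariance of the new gain.\<close>

lemma cost_difference:
  assumes K': "K' \<in> stabilizing A B"
  shows "cost K' = cost K + trace (bellman_defect K K' ** state_cov A B \<Psi> \<sigma> K')"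
proof -
  let ?W = "weight K' - bellman_defect K K'" and ?S = "state_cov A B \<Psi> \<sigma> K'"
  have "?W + bellman_defect K K' = weight K'" by simp
  then have "trace (weight K' ** ?S) = trace (?W ** ?S) + trace (bellman_defect K K' ** ?S)"
    by (metis matrix_add_rdistrib trace_add)
  moreover have "?S = noise + closed_loop K' ** ?S ** transpose (closed_loop K')"
    unfolding state_cov_def
    using theI'[OF lyapunov_ex1[OF matpow_transpose_tendsto_0[OF spectral_radius_less_1_tendsto_0]],
        of "closed_loop K'" noise] K'
    by (simp only: transpose_transpose stabilizing_def mem_Collect_eq)
  moreover have "val K = ?W + transpose (closed_loop K') ** val K ** closed_loop K'"
    by (simp add: bellman_defect_def)
  ultimately have "trace (weight K' ** ?S) = trace (val K ** noise) + trace (bellman_defect K K' ** ?S)"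
    using lyapunov_duality by metis
  then show ?thesis by (simp add: cost_eq_val) (simp add: cost_def)
qed

text \<open>Along the new loop the form of \<open>val K\<close> drops by the weight form minus the
  defect form, at least \<open>(sigma_min Q - d) (x \<bullet> x)\<close>.\<close>

lemma stabilizing_if_bellman_defect_le:
  assumes "\<And>x. x \<bullet> (bellman_defect K K' *v x) \<le> d * (x \<bullet> x)" "d < sigma_min Q"
  shows "K' \<in> stabilizing A B"
proof -
  let ?M = "closed_loop K'"
  have "(?M *v x) \<bullet> (val K *v (?M *v x)) < x \<bullet> (val K *v x)" if "x \<noteq> 0" for x
  proof -
    note bellman_defect_split[of x K K']
    moreover have "d * (x \<bullet> x) < sigma_min Q * (x \<bullet> x)" using assms(2) that by simp
    ultimately show ?thesis
      using assms(1)[of x] weight_ge[of x K'] sigma_min_sym_pos_def(2)[OF Q, of x] by linarith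
  qed
  with spectral_radius_less_1_if_lyapunov_decrease[of "val K" ?M] psd_val
  show ?thesis by (simp add: stabilizing_def psd_def)
qed

text \<open>Completing the square in the move from \<open>K\<close> to \<open>Ks\<close> bounds the
  defect below by \<open>- (g \<bullet> g) / sigma_min R\<close>. Pairing this with the covariance
  of \<open>Ks\<close>, whose trace is controlled by \<open>cost Ks\<close>, gives the
  claim.\<close>

lemma gradient_domination:
  assumes Ks: "Ks \<in> stabilizing A B"
  shows "sigma_min Q * sigma_min R * (cost K - cost Ks) \<le> cost Ks * (norm (grad K))\<^sup>2"
proof -
  let ?r = "sigma_min R" and ?S = "state_cov A B \<Psi> \<sigma> Ks"
  have r: "?r > 0" by (rule sigma_min_sym_pos_def(1)[OF R])
  have "- ((norm (grad K))\<^sup>2 / ?r) * (x \<bullet> x) \<le> x \<bullet> (bellman_defect K Ks *v x)" for x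
  proof -
    define y g where "y = (Ks - K) *v x" and "g = grad K *v x"
    have "0 \<le> ?r * ((y + (1 / ?r) *\<^sub>R g) \<bullet> (y + (1 / ?r) *\<^sub>R g))" using r by simp
    also have "\<dots> = ?r * (y \<bullet> y) + 2 * (y \<bullet> g) + (g \<bullet> g) / ?r"
      using r by (simp add: inner_add_left inner_add_right inner_commute field_simps)
    also have "?r * (y \<bullet> y) \<le> y \<bullet> (R *v y)" by (rule sigma_min_sym_pos_def(2)[OF R])
    finally have "- (g \<bullet> g) / ?r \<le> x \<bullet> (bellman_defect K Ks *v x)"
      using psd_nonneg[OF psd_val, of "B *v y"] by (simp add: bellman_defect_form y_def g_def)
    moreover have "g \<bullet> g \<le> (norm (grad K))\<^sup>2 * (x \<bullet> x)"
      using power_mono[OF norm_matrix_vector_mult_le[of "grad K" x], of 2]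
      by (simp add: g_def power_mult_distrib power2_norm_eq_inner)
    then have "(g \<bullet> g) / ?r \<le> (norm (grad K))\<^sup>2 / ?r * (x \<bullet> x)"
      using r by (simp add: field_simps)
    ultimately show ?thesis by simp
  qed
  from trace_psd_ge_scaled[OF lqr.psd_cov[OF lqr_axioms Ks, of \<sigma>] this]
  have "cost K - cost Ks \<le> (norm (grad K))\<^sup>2 / ?r * trace ?S"
    using cost_difference[OF Ks] by linarith
  then have "?r * (cost K - cost Ks) \<le> (norm (grad K))\<^sup>2 * trace ?S"
    using r by (simp add: field_simps)
  then have "sigma_min Q * (?r * (cost K - cost Ks)) \<le> sigma_min Q * ((norm (grad K))\<^sup>2 * trace ?S)"
    using sigma_min_sym_pos_def(1)[OF Q] by (simp add: mult_left_mono)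
  also have "\<dots> = (norm (grad K))\<^sup>2 * (sigma_min Q * trace ?S)" by (simp add: mult_ac)
  also have "\<dots> \<le> (norm (grad K))\<^sup>2 * cost Ks"
    by (intro mult_left_mono lqr.trace_cov_le[OF lqr_axioms Ks]) simp
  finally show ?thesis by (simp add: mult_ac)
qed

lemma hessian_form_le:
  "y \<bullet> (R *v y) + (B *v y) \<bullet> (val K *v (B *v y))
    \<le> (op_norm R + (op_norm B)\<^sup>2 * (cost K / sigma_min \<Psi>)) * (y \<bullet> y)"
proof -
  have p: "trace (val K) \<le> cost K / sigma_min \<Psi>"
    using trace_val_le sigma_min_sym_pos_def(1)[OF \<Psi>] by (simp add: field_simps)
  have "(B *v y) \<bullet> (B *v y) \<le> (op_norm B)\<^sup>2 * (y \<bullet> y)"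
    using power_mono[OF norm_matrix_vector_le_op_norm[of B y], of 2]
    by (simp add: power_mult_distrib power2_norm_eq_inner)
  then have "trace (val K) * ((B *v y) \<bullet> (B *v y)) \<le> cost K / sigma_min \<Psi> * ((op_norm B)\<^sup>2 * (y \<bullet> y))"
    using p psd_trace_nonneg[OF psd_val] by (intro mult_mono) auto
  with psd_le_trace[OF psd_val, of "B *v y"] quadratic_form_le_op_norm[of y R]
  show ?thesis by (simp add: algebra_simps)
qed

section \<open>One inexact gradient step\<close>

context
  fixes s :: real and \<Delta> K' :: "real^'n^'m"
  assumes s: "s > 0" "s * (op_norm R + (op_norm B)\<^sup>2 * (cost K / sigma_min \<Psi>)) \<le> 1 / 2"
    and K': "K' = K - s *\<^sub>R (grad K - \<Delta>)"
begin

text \<open>With \<open>a\<close> the gradient and \<open>b\<close> the error at \<open>x\<close>,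
  the linear term equals \<open>s (b \<bullet> b - a \<bullet> a) - s |a - b|^2\<close>. The
  step-size condition limits the quadratic term to half of that last square.\<close>

lemma bellman_defect_step_le:
  "x \<bullet> (bellman_defect K K' *v x) \<le> s * ((\<Delta> *v x) \<bullet> (\<Delta> *v x) - (grad K *v x) \<bullet> (grad K *v x))"
proof -
  define a b y where "a = grad K *v x" and "b = \<Delta> *v x" and "y = (K' - K) *v x"
  let ?h = "op_norm R + (op_norm B)\<^sup>2 * (cost K / sigma_min \<Psi>)"
  have y: "y = - s *\<^sub>R (a - b)"
    by (simp add: y_def K' a_def b_def mat_scaleR_mult_vec matrix_vector_mult_diff_rdistrib
        flip: scaleR_minus_left)
  have yy: "y \<bullet> y = s\<^sup>2 * ((a - b) \<bullet> (a - b))" by (simp add: y power2_eq_square)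
  have "?h * (y \<bullet> y) = s * ?h * (s * ((a - b) \<bullet> (a - b)))"
    by (simp add: yy power2_eq_square)
  also have "\<dots> \<le> 1 / 2 * (s * ((a - b) \<bullet> (a - b)))"
    using s by (intro mult_right_mono) auto
  finally have "x \<bullet> (bellman_defect K K' *v x) \<le> s / 2 * ((a - b) \<bullet> (a - b)) + 2 * (y \<bullet> a)"
    using hessian_form_le[of y]
    unfolding bellman_defect_form y_def[symmetric] a_def[symmetric] by linarith
  also have "\<dots> = s * (b \<bullet> b - a \<bullet> a) - s / 2 * ((a - b) \<bullet> (a - b))"
    by (simp add: y inner_diff_left inner_diff_right inner_commute algebra_simps)
  also have "\<dots> \<le> s * (b \<bullet> b - a \<bullet> a)" using s(1) by simp
  finally show ?thesis by (simp add: a_def b_def)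
qed

lemma stabilizing_step:
  assumes "s * (norm \<Delta>)\<^sup>2 < sigma_min Q"
  shows "K' \<in> stabilizing A B"
proof (rule stabilizing_if_bellman_defect_le[OF _ assms])
  fix x
  have "(\<Delta> *v x) \<bullet> (\<Delta> *v x) - (grad K *v x) \<bullet> (grad K *v x) \<le> (norm \<Delta>)\<^sup>2 * (x \<bullet> x)"
    using power_mono[OF norm_matrix_vector_mult_le[of \<Delta> x], of 2]
      inner_ge_zero[of "grad K *v x"]
    by (simp add: power_mult_distrib power2_norm_eq_inner del: inner_ge_zero)
  from mult_left_mono[OF this less_imp_le[OF s(1)]] bellman_defect_step_le[of x]
  show "x \<bullet> (bellman_defect K K' *v x) \<le> s * (norm \<Delta>)\<^sup>2 * (x \<bullet> x)" unfolding mult.assoc by linarith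
qed

lemma cost_step_le:
  assumes "K' \<in> stabilizing A B"
  shows "cost K' \<le> cost K - s * sigma_min \<Psi> * (norm (grad K))\<^sup>2
      + s * (norm \<Delta>)\<^sup>2 * trace (state_cov A B \<Psi> \<sigma> K')"
proof -
  let ?S = "state_cov A B \<Psi> \<sigma> K'" and ?E = "grad K"
  let ?N = "transpose \<Delta> ** \<Delta>" and ?G = "transpose ?E ** ?E"
  note psd_S = lqr.psd_cov[OF lqr_axioms assms]
  have self: "x \<bullet> ((transpose F ** F) *v x) = (F *v x) \<bullet> (F *v x)" for F :: "real^'n^'m" and x
    by (simp only: inner_transpose_matrix_vector flip: matrix_vector_mul_assoc)
  have "trace (bellman_defect K K' ** ?S) \<le> trace ((s *\<^sub>R (?N - ?G)) ** ?S)"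
    by (rule trace_psd_mono[OF psd_S])
      (simp only: mat_scaleR_mult_vec matrix_vector_mult_diff_rdistrib inner_diff_right
        inner_scaleR_right self bellman_defect_step_le)
  also have "\<dots> = s * (trace (?N ** ?S) - trace (?G ** ?S))"
  proof -
    have "(?N - ?G) ** ?S + ?G ** ?S = ?N ** ?S" by (simp flip: matrix_add_rdistrib)
    then have "trace ((?N - ?G) ** ?S) = trace (?N ** ?S) - trace (?G ** ?S)"
      by (metis add_diff_cancel_right' trace_add)
    then show ?thesis by (simp add: trace_scaleR flip: scalar_matrix_assoc)
  qed
  also have "\<dots> \<le> s * ((norm \<Delta>)\<^sup>2 * trace ?S - sigma_min \<Psi> * (norm ?E)\<^sup>2)"
  proof (intro mult_left_mono diff_mono)
    show "trace (?N ** ?S) \<le> (norm \<Delta>)\<^sup>2 * trace ?S"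
    proof (rule trace_psd_le_scaled[OF psd_S])
      fix x
      show "x \<bullet> (?N *v x) \<le> (norm \<Delta>)\<^sup>2 * (x \<bullet> x)"
        using power_mono[OF norm_matrix_vector_mult_le[of \<Delta> x], of 2]
        unfolding self by (simp add: power_mult_distrib power2_norm_eq_inner)
    qed
    \<comment> \<open>The gradient term enters negatively, so the covariance is bounded below by
      \<open>sigma_min \<Psi>\<close> times the identity.\<close>
    have "0 \<le> trace (?G ** (?S - sigma_min \<Psi> *\<^sub>R mat 1))"
      by (rule trace_psd_nonneg[OF lqr.psd_cov_minus[OF lqr_axioms assms]]) (simp only: self inner_ge_zero)
    moreover have "?G ** (?S - sigma_min \<Psi> *\<^sub>R mat 1) + sigma_min \<Psi> *\<^sub>R ?G = ?G ** ?S"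
    proof -
      have "sigma_min \<Psi> *\<^sub>R ?G = ?G ** (sigma_min \<Psi> *\<^sub>R mat 1)" by (simp add: matrix_mult_scaleR_right)
      then show ?thesis by (simp flip: matrix_add_ldistrib)
    qed
    ultimately show "sigma_min \<Psi> * (norm ?E)\<^sup>2 \<le> trace (?G ** ?S)"
      by (metis add_le_cancel_right add_0 trace_add trace_scaleR trace_transpose_mult_self)
  qed (use s in auto)
  finally show ?thesis using cost_difference[OF assms] by (simp add: algebra_simps)
qed

end

end

text \<open>The order avoids circularity: a crude error bound first gives stability, then the
  descent inequality bounds the new covariance, and only then is the error term estimated
  sharply.\<close>

lemma inexact_natural_gradient_step:
  fixes K K' Ks \<Delta> :: "real^'n^'m" and \<epsilon> J0 C1 C2 :: real
  assumes K: "K \<in> stabilizing A B" and Ks: "Ks \<in> stabilizing A B"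
    and J0: "cost Ks \<le> J0" "cost K \<le> 2 * J0" and \<epsilon>: "0 < \<epsilon>" "\<epsilon> \<le> J0"
    and C1: "C1 = 2 * (op_norm R + 2 * inverse (sigma_min \<Psi>) * (op_norm B)\<^sup>2 * J0)"
    and C2: "C2 = sigma_min \<Psi> * sigma_min Q * sigma_min R"
    and err: "(norm \<Delta>)\<^sup>2 \<le> C2 / (60 * J0)
      * min (C2 / (sigma_min \<Psi> * cost Ks * C1)) (1 / (4 * (J0 / sigma_min Q))) * \<epsilon>"
    and K': "K' = K - (1 / C1) *\<^sub>R (grad K - \<Delta>)"
  defines "\<theta> \<equiv> C2 / (C1 * cost Ks)"
  shows "0 < \<theta>" "\<theta> \<le> 1 / 2" "K' \<in> stabilizing A B"
    and "cost K' - cost Ks \<le> (1 - \<theta>) * (cost K - cost Ks) + \<theta> * (\<epsilon> / 40)"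
proof -
  define a q r where "a = sigma_min \<Psi>" and "q = sigma_min Q" and "r = sigma_min R"
  define g2 n2 where "g2 = (norm (grad K))\<^sup>2" and "n2 = (norm \<Delta>)\<^sup>2"
  have pos: "a > 0" "q > 0" "r > 0"
    by (simp_all add: a_def q_def r_def sigma_min_sym_pos_def(1) Q R \<Psi>)
  have Jpos: "q * a \<le> cost Ks" "0 < cost Ks" "0 < J0"
    using cost_ge[OF Ks] J0 pos by (auto simp: a_def q_def intro: less_le_trans[of 0 "q * a"])
  define X where "X = 2 * inverse a * (op_norm B)\<^sup>2 * J0"
  have "0 \<le> X" "C1 = 2 * (op_norm R + X)" using pos Jpos by (simp_all add: X_def C1 a_def)
  then have C1r: "2 * r \<le> C1"
    using sigma_min_le_op_norm[OF R] by (simp add: r_def)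
  then have C1pos: "C1 > 0" using pos by linarith
  have C2': "C2 = a * q * r" by (simp add: C2 a_def q_def r_def)
  then have C2pos: "C2 > 0" using pos by simp
  show \<theta>pos: "0 < \<theta>" using C2pos C1pos Jpos by (simp add: \<theta>_def)
  have C2le: "C2 \<le> cost Ks * C1 / 2"
    using mult_mono[OF Jpos(1) C1r] pos Jpos by (simp add: C2' mult_ac)
  then show "\<theta> \<le> 1 / 2" using C1pos Jpos by (simp add: \<theta>_def field_simps)
  have step_size: "1 / C1 * (op_norm R + (op_norm B)\<^sup>2 * (cost K / sigma_min \<Psi>)) \<le> 1 / 2"
  proof -
    have "(op_norm B)\<^sup>2 * (cost K / a) \<le> (op_norm B)\<^sup>2 * (2 * J0 / a)"
      using J0 pos by (intro mult_left_mono divide_right_mono) auto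
    also have "\<dots> = X" by (simp add: X_def field_simps)
    also have "X = C1 / 2 - op_norm R" using \<open>C1 = 2 * (op_norm R + X)\<close> by (simp add: field_simps)
    finally have "op_norm R + (op_norm B)\<^sup>2 * (cost K / sigma_min \<Psi>) \<le> C1 / 2"
      by (simp only: a_def le_diff_eq add.commute)
    then show ?thesis using C1pos by (simp add: field_simps)
  qed
  have "C2 / (60 * J0) * min u v * \<epsilon> \<le> C2 / (60 * J0) * u * \<epsilon>"
    and "C2 / (60 * J0) * min u v * \<epsilon> \<le> C2 / (60 * J0) * v * \<epsilon>" for u v
    using C2pos Jpos \<epsilon> by (intro mult_right_mono mult_left_mono; simp)+
  from this[THEN order_trans[OF err]]
  have n2a: "n2 \<le> C2 / (60 * J0) * (C2 / (a * cost Ks * C1)) * \<epsilon>"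
    and n2b: "n2 \<le> C2 / (60 * J0) * (1 / (4 * (J0 / q))) * \<epsilon>"
    unfolding n2_def a_def q_def by blast+
  \<comment> \<open>From the second entry of the minimum, using \<open>\<epsilon> \<le> J0\<close>
    and \<open>C2 \<le> J0 C1 / 2\<close>.\<close>
  have n2q: "1 / C1 * n2 \<le> q / 480"
  proof -
    have "n2 \<le> C2 / (60 * J0) * (1 / (4 * (J0 / q))) * J0"
      using n2b \<epsilon> C2pos Jpos pos by (elim order_trans) (intro mult_left_mono, auto)
    also have "\<dots> = C2 * q / (240 * J0)" using Jpos pos by (simp add: field_simps)
    also have "\<dots> \<le> (J0 * C1 / 2) * q / (240 * J0)"
    proof (intro divide_right_mono mult_right_mono)
      show "C2 \<le> J0 * C1 / 2"
        using C2le mult_right_mono[OF J0(1), of C1] C1pos by linarith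
    qed (use Jpos pos in auto)
    also have "\<dots> = C1 * (q / 480)" using Jpos by simp
    finally show ?thesis using C1pos by (simp add: field_simps)
  qed
  have s: "0 < 1 / C1" using C1pos by simp
  show stab: "K' \<in> stabilizing A B"
  proof (rule stabilizing_step[OF K s step_size K'])
    have "q / 480 < q" using pos by simp
    with n2q show "1 / C1 * (norm \<Delta>)\<^sup>2 < sigma_min Q"
      unfolding n2_def q_def by (rule le_less_trans)
  qed
  define t where "t = trace (cov K')"
  have t: "0 \<le> t" "q * t \<le> cost K'"
    using psd_trace_nonneg[OF psd_cov[OF stab]] trace_cov_le[OF stab] by (simp_all add: t_def q_def)
  have descent: "cost K' \<le> cost K - 1 / C1 * a * g2 + 1 / C1 * n2 * t"
    using cost_step_le[OF K s step_size K' stab] by (simp add: a_def g2_def n2_def t_def)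
  \<comment> \<open>Bootstrap: \<open>q t \<le> cost K' \<le> 2 J0 + q t / 480\<close>, and the last
    term is absorbed on the left.\<close>
  have "1 / C1 * n2 * t \<le> q / 480 * t" using n2q t(1) by (rule mult_right_mono)
  moreover have "0 \<le> 1 / C1 * a * g2" using C1pos pos by (simp add: g2_def)
  ultimately have qt: "q * t \<le> 3 * J0" using descent t(2) J0(2) Jpos by linarith
  \<comment> \<open>The first entry of the minimum now applies: \<open>3 / 60\<close> leaves
    \<open>1 / 20\<close>, and \<open>r \<le> C1 / 2\<close> turns it into
    \<open>1 / 40\<close>.\<close>
  have "1 / C1 * n2 * t \<le> \<theta> * (\<epsilon> / 40)"
  proof -
    have "n2 * (q * t) \<le> (C2 / (60 * J0) * (C2 / (a * cost Ks * C1)) * \<epsilon>) * (3 * J0)"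
      by (rule mult_mono[OF n2a qt]) (use t pos C2pos C1pos Jpos \<epsilon> in simp_all)
    also have "\<dots> = \<theta> * \<epsilon> / 20 * q * r"
      using pos C1pos Jpos by (simp add: \<theta>_def C2' field_simps)
    finally have "n2 * t \<le> \<theta> * \<epsilon> / 20 * r" using pos by (simp add: field_simps)
    also have "\<dots> \<le> \<theta> * \<epsilon> / 20 * (C1 / 2)"
      using C1r \<theta>pos \<epsilon> by (intro mult_left_mono) auto
    finally show ?thesis using C1pos by (simp add: field_simps)
  qed
  moreover have "\<theta> * (cost K - cost Ks) \<le> 1 / C1 * a * g2"
  proof -
    have "q * r * (cost K - cost Ks) \<le> cost Ks * g2"
      using gradient_domination[OF K Ks] by (simp add: q_def r_def g2_def)
    then have "a / (C1 * cost Ks) * (q * r * (cost K - cost Ks)) \<le> a / (C1 * cost Ks) * (cost Ks * g2)"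
      using pos C1pos Jpos by (intro mult_left_mono) auto
    then show ?thesis using Jpos by (simp add: \<theta>_def C2' mult_ac)
  qed
  ultimately have "cost K - 1 / C1 * a * g2 + 1 / C1 * n2 * t
      \<le> cost K - \<theta> * (cost K - cost Ks) + \<theta> * (\<epsilon> / 40)"
    by (intro add_mono diff_mono order_refl)
  from order_trans[OF descent this]
  show "cost K' - cost Ks \<le> (1 - \<theta>) * (cost K - cost Ks) + \<theta> * (\<epsilon> / 40)"
    by (simp add: algebra_simps)
qed

lemma lqr_cost_eq: "K \<in> stabilizing A B \<Longrightarrow> lqr_cost A B Q R \<Psi> \<sigma> K = ereal (cost K)"
  by (simp add: lqr_cost_def cost_def)

end

section \<open>Convergence\<close>

text \<open>From \<open>exp y \<le> 1 + y + y^2\<close> on the unit interval with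
  \<open>y = x ln 2 \<le> x\<close>; it serves to bound \<open>2^(1/l)\<close>.\<close>

lemma two_powr_le: "2 powr x \<le> 1 + 2 * x" if "0 \<le> x" "x \<le> 1" for x :: real
proof -
  have ln2: "0 \<le> ln (2::real)" "ln (2::real) \<le> 1" using ln_2_less_1 by simp_all
  define y where "y = x * ln 2"
  have y: "0 \<le> y" "y \<le> x" "y \<le> 1"
    using that ln2 mult_left_mono[of "ln 2" 1 x] by (auto simp: y_def)
  have "y\<^sup>2 \<le> y" using y by (simp add: power2_eq_square mult_left_le)
  with exp_bound[of y] y have "exp y \<le> 1 + 2 * x" by linarith
  then show ?thesis by (simp add: powr_def y_def)
qed

text \<open>Until \<open>J0 2\<^sup>-\<^sup>t\<^sup>/\<^sup>l\<close> drops below \<open>\<epsilon>\<close>, the perturbation \<open>\<theta> \<epsilon> / 40\<close> is absorbed by the contraction,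
  because \<open>(1 - \<theta>) 2\<^sup>1\<^sup>/\<^sup>l + \<theta> / 40 \<le> 1\<close>.\<close>

lemma perturbed_contraction_rate:
  fixes a :: "nat \<Rightarrow> real" and l :: int
  assumes step: "\<And>t. t < T \<Longrightarrow> a (Suc t) \<le> (1 - \<theta>) * a t + \<theta> * (\<epsilon> / 40)"
    and \<theta>: "0 < \<theta>" "\<theta> \<le> 1 / 2" and l: "8 / \<theta> \<le> l" and \<epsilon>: "0 < \<epsilon>" "\<epsilon> \<le> b" and a0: "a 0 \<le> b"
    and t: "t \<le> T" "t \<le> l * log 2 (b / \<epsilon>)"
  shows "a t \<le> 2 powr (- (t / l)) * b"
  using t
proof (induction t)
  case 0
  with a0 show ?case by simp
next
  case (Suc t)
  have "0 < 8 / \<theta>" using \<theta> by simp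
  with l have lpos: "0 < real_of_int l" by linarith
  define y where "y = 2 powr (- (Suc t / l)) * b"
  have b: "0 < b" using \<epsilon> by linarith
  \<comment> \<open>The time restriction keeps the next target \<open>y\<close> at or above
    \<open>\<epsilon>\<close>.\<close>
  have "Suc t / l \<le> log 2 (b / \<epsilon>)" using Suc.prems(2) lpos by (simp add: field_simps)
  then have "2 powr (Suc t / l) \<le> b / \<epsilon>"
    using b \<epsilon> by (simp add: le_log_iff)
  then have "\<epsilon> \<le> y"
    using \<epsilon> by (simp add: y_def powr_minus field_simps)
  then have ypos: "0 < y" using \<epsilon> by linarith
  have "real t \<le> l * log 2 (b / \<epsilon>)" using Suc.prems(2) by simp
  then have "a t \<le> 2 powr (- (t / l)) * b" using Suc by simp
  also have "- (t / l) = - (Suc t / l) + 1 / l" using lpos by (simp add: field_simps)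
  also have "2 powr (- (Suc t / l) + 1 / l) * b = 2 powr (1 / l) * y"
    unfolding y_def powr_add by (simp add: mult_ac)
  also have "2 powr (1 / l) \<le> 1 + \<theta> / 4"
  proof -
    have "1 / l \<le> \<theta> / 8" using l \<theta> lpos by (simp add: field_simps)
    then show ?thesis using two_powr_le[of "1 / l"] lpos \<theta> by simp
  qed
  finally have "a t \<le> (1 + \<theta> / 4) * y" using ypos by simp
  then have "(1 - \<theta>) * a t \<le> (1 - \<theta>) * ((1 + \<theta> / 4) * y)" using \<theta> by (intro mult_left_mono) auto
  moreover have "\<theta> * (\<epsilon> / 40) \<le> \<theta> * (y / 40)" using \<open>\<epsilon> \<le> y\<close> \<theta> by simp
  \<comment> \<open>The contraction gains \<open>3 / 4\<close> of \<open>\<theta>\<close> and the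
    perturbation costs \<open>1 / 40\<close>, leaving \<open>29 / 40\<close>.\<close>
  moreover have "(1 - \<theta>) * ((1 + \<theta> / 4) * y) + \<theta> * (y / 40) = y - y * (\<theta> * (29 / 40) + \<theta> * \<theta> / 4)"
    by (simp add: field_simps)
  moreover have "0 \<le> y * (\<theta> * (29 / 40) + \<theta> * \<theta> / 4)" using ypos \<theta> by simp
  ultimately show ?case using step[of t] Suc.prems(1) unfolding y_def[symmetric] by simp
qed

theorem theorem3p5:
  fixes A :: "real^'n^'n" and B :: "real^'m^'n"
    and Q :: "real^'n^'n" and R :: "real^'m^'m" and \<Psi> :: "real^'n^'n"
    and K E \<delta> :: "nat \<Rightarrow> real^'n^'m" and Kstar :: "real^'n^'m"
    and J :: "real^'n^'m \<Rightarrow> ereal"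
    and \<sigma> \<epsilon> \<eta> \<kappa> J0 Jstar C1 C2 C3 C4 C5 C6 C7 :: real
    and T :: nat and l :: int
  assumes "controllable A B"
    and "sym_pos_def Q" and "sym_pos_def R" and "sym_pos_def \<Psi>" and "\<sigma> \<ge> 0"
    and J: "J = lqr_cost A B Q R \<Psi> \<sigma>"
    and "Kstar \<in> stabilizing A B" and "\<And>L. J Kstar \<le> J L"
    and "K 0 \<in> stabilizing A B"
    and J0: "J0 = real_of_ereal (J (K 0))" and Jstar: "Jstar = real_of_ereal (J Kstar)"
    and C1: "C1 = 2 * (op_norm R + 2 * inverse (sigma_min \<Psi>) * (op_norm B)\<^sup>2 * J0)"
    and C2: "C2 = sigma_min \<Psi> * sigma_min Q * sigma_min R"
    and C3: "C3 = J0 / sigma_min Q"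
    and C4: "C4 = op_norm A + op_norm B * sqrt (2 * J0 / (sigma_min \<Psi> * sigma_min R))"
    and "0 < \<epsilon>" and "\<epsilon> \<le> J0" and "T \<ge> 1"
    and \<kappa>: "\<kappa> = 8 * Jstar * C1 / C2" and l: "l = \<lceil>\<kappa>\<rceil>"
    and \<eta>: "\<eta> = 1 / (2 * C1)"
    and step: "\<And>t. t < T \<Longrightarrow> K (Suc t) = K t - (2 * \<eta>) *\<^sub>R E t"
    and \<delta>: "\<And>t. t < T \<Longrightarrow> \<delta> t = natural_gradient A B Q R (K t) - E t"
    and C5: "C5 = (op_norm B * sigma_min Q / (2 * (C4 + 1)))\<^sup>2"
    and C6: "C6 = (sigma_min \<Psi> * C2 / (1920 * J0 * op_norm B * C3\<^sup>2 * (C4 + 1)) * \<epsilon>)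
                    powr (2 / 3)"
    and C7: "C7 = C2 / (60 * J0)
                    * min (C2 / (sigma_min \<Psi> * Jstar * C1)) (1 / (4 * C3)) * \<epsilon>"
    and err: "\<And>t. t < T \<Longrightarrow> K t \<in> stabilizing A B \<Longrightarrow>
                (norm (\<delta> t))\<^sup>2 \<le> min C5 (min C6 C7)"
  shows "\<forall>t\<le>T.
      K t \<in> stabilizing A B
    \<and> (t \<ge> 1 \<longrightarrow> J (K t) \<le> J (K (t - 1)) \<or> J (K t) - J Kstar \<le> ereal \<epsilon>)
    \<and> (real t \<le> real_of_int l * log 2 (J0 / \<epsilon>) \<longrightarrow>
         J (K t) - J Kstar \<le> ereal (2 powi (- \<lfloor>real t / real_of_int l\<rfloor>) * J0))"
proof -
  interpret lqr A B Q R \<Psi> \<sigma>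
    by unfold_locales fact+
  have K0: "K 0 \<in> stabilizing A B" and Ks: "Kstar \<in> stabilizing A B" by fact+
  have J_eq: "J L = ereal (cost L)" if "L \<in> stabilizing A B" for L
    using that by (simp add: J lqr_cost_eq)
  have J0: "J0 = cost (K 0)" and Jstar: "Jstar = cost Kstar"
    using J0 Jstar J_eq K0 Ks by simp_all
  have opt: "Jstar \<le> cost L" if "L \<in> stabilizing A B" for L
    using assms(8)[of L] J_eq[OF that] J_eq[OF Ks] by (simp add: Jstar)
  define \<theta> where "\<theta> = C2 / (C1 * Jstar)"
  define a where "a t = cost (K t) - Jstar" for t
  have progress: "0 < \<theta>" "\<theta> \<le> 1 / 2" "K (Suc t) \<in> stabilizing A B"
      "a (Suc t) \<le> (1 - \<theta>) * a t + \<theta> * (\<epsilon> / 40)"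
    if "t < T" "K t \<in> stabilizing A B" "a t \<le> max (J0 - Jstar) \<epsilon>" for t
  proof -
    \<comment> \<open>In either case of the maximum: the cost is at most \<open>J0\<close>, or at
      most \<open>Jstar + \<epsilon>\<close>, which is at most \<open>2 J0\<close>.\<close>
    have "cost (K t) \<le> 2 * J0"
      using that(3) opt[OF K0] \<open>\<epsilon> \<le> J0\<close> \<open>0 < \<epsilon>\<close> by (auto simp: a_def J0 max_def split: if_splits)
    moreover have "(norm (\<delta> t))\<^sup>2 \<le> C2 / (60 * J0)
      * min (C2 / (sigma_min \<Psi> * cost Kstar * C1)) (1 / (4 * (J0 / sigma_min Q))) * \<epsilon>"
      using err[OF that(1,2)] by (simp add: C7 C3 Jstar)
    moreover have "K (Suc t) = K t - (1 / C1) *\<^sub>R (grad (K t) - \<delta> t)"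
      using step[OF that(1)] \<delta>[OF that(1)] by (simp add: \<eta>)
    ultimately show "0 < \<theta>" "\<theta> \<le> 1 / 2" "K (Suc t) \<in> stabilizing A B"
      "a (Suc t) \<le> (1 - \<theta>) * a t + \<theta> * (\<epsilon> / 40)"
      using inexact_natural_gradient_step[OF that(2) Ks _ _ \<open>0 < \<epsilon>\<close> \<open>\<epsilon> \<le> J0\<close> C1 C2] opt[OF K0]
      unfolding \<theta>_def a_def J0[symmetric] Jstar[symmetric] by blast+
  qed
  \<comment> \<open>The invariant survives because the next excess is at most a convex combination
    of two numbers below the maximum.\<close>
  have inv: "K t \<in> stabilizing A B \<and> a t \<le> max (J0 - Jstar) \<epsilon>" if "t \<le> T" for t
    using that
  proof (induction t)
    case 0
    then show ?case using K0 by (simp add: a_def J0)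
  next
    case (Suc t)
    then have t: "t < T" "K t \<in> stabilizing A B" "a t \<le> max (J0 - Jstar) \<epsilon>" by auto
    note p = progress[OF t]
    have "(1 - \<theta>) * a t \<le> (1 - \<theta>) * max (J0 - Jstar) \<epsilon>"
      using p(2) t(3) by (intro mult_left_mono) auto
    moreover have "\<theta> * (\<epsilon> / 40) \<le> \<theta> * max (J0 - Jstar) \<epsilon>"
      using p(1) \<open>0 < \<epsilon>\<close> by (intro mult_left_mono order_trans[OF _ max.cobounded2]) auto
    ultimately have "a (Suc t) \<le> max (J0 - Jstar) \<epsilon>"
      using p(4) by (simp add: algebra_simps)
    with p(3) show ?case by simp
  qed
  \<comment> \<open>Free of \<open>t\<close>, these bounds are read off from the first step, which
    exists as \<open>T \<ge> 1\<close>.\<close>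
  have \<theta>: "0 < \<theta>" "\<theta> \<le> 1 / 2"
    using progress(1,2)[of 0] inv[of 0] \<open>T \<ge> 1\<close> by auto
  have contraction: "a (Suc t) \<le> (1 - \<theta>) * a t + \<theta> * (\<epsilon> / 40)" if "t < T" for t
    using progress(4)[OF that] inv[of t] that by simp
  have "0 < Jstar" using cost_ge[OF Ks] sigma_min_sym_pos_def(1)[OF Q] sigma_min_sym_pos_def(1)[OF \<Psi>]
    by (auto simp: Jstar intro: less_le_trans[of 0 "sigma_min Q * sigma_min \<Psi>"])
  \<comment> \<open>Here \<open>8 / \<theta>\<close> is \<open>\<kappa>\<close>, and
    \<open>l\<close> is its ceiling.\<close>
  have "8 / \<theta> \<le> real_of_int l"
    unfolding l \<kappa> \<theta>_def by (simp add: mult_ac)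
  note rate = perturbed_contraction_rate[where a = a and T = T, OF contraction \<theta> this \<open>0 < \<epsilon>\<close> \<open>\<epsilon> \<le> J0\<close>]
  have Jdiff: "J (K t) - J Kstar = ereal (a t)" if "t \<le> T" for t
    using inv[OF that] Ks by (simp add: J_eq a_def Jstar)
  show ?thesis
  proof (intro allI impI conjI)
    fix t assume t: "t \<le> T"
    then show "K t \<in> stabilizing A B" using inv by blast
    show "J (K t) \<le> J (K (t - 1)) \<or> J (K t) - J Kstar \<le> ereal \<epsilon>" if t1: "1 \<le> t"
    proof -
      obtain u where u: "t = Suc u" "u < T" using t1 t by (cases t) auto
      have step: "a t \<le> a u + \<theta> * (\<epsilon> / 40 - a u)"
        using contraction[OF u(2)] u(1) by (simp add: algebra_simps)
      show ?thesis
      \<comment> \<open>Above this fixed point of the recursion the cost cannot increase; below it,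
        \<open>\<theta> \<le> 1\<close> keeps the next excess at most
        \<open>\<epsilon> / 40\<close>.\<close>
      proof (cases "a u \<ge> \<epsilon> / 40")
        case True
        then have "\<theta> * (\<epsilon> / 40 - a u) \<le> 0" using \<theta> by (intro mult_nonneg_nonpos) auto
        with step have "cost (K t) \<le> cost (K u)" by (simp add: a_def)
        then show ?thesis using inv[of t] inv[of u] t u by (simp add: J_eq)
      next
        case False
        then have "\<theta> * (\<epsilon> / 40 - a u) \<le> 1 * (\<epsilon> / 40 - a u)" using \<theta> by (intro mult_right_mono) auto
        from order_trans[OF step add_left_mono[OF this]] \<open>0 < \<epsilon>\<close> have "a t \<le> \<epsilon>" by simp
        then show ?thesis using Jdiff[OF t] by simp
      qed
    qed
    show "J (K t) - J Kstar \<le> ereal (2 powi (- \<lfloor>real t / real_of_int l\<rfloor>) * J0)"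
      if "real t \<le> real_of_int l * log 2 (J0 / \<epsilon>)"
    proof -
      have "a t \<le> 2 powr (- (t / l)) * J0"
        by (rule rate[OF _ _ t that]) (use \<open>0 < Jstar\<close> in \<open>simp_all add: a_def J0\<close>)
      \<comment> \<open>The continuous rate is stronger than the stated one; rounding
        \<open>t / l\<close> down only weakens it.\<close>
      also have "2 powr (- (t / l)) \<le> 2 powr (real_of_int (- \<lfloor>t / l\<rfloor>))"
        by (intro powr_mono) auto
      also have "\<dots> = 2 powi (- \<lfloor>t / l\<rfloor>)" by (rule powr_real_of_int') simp_all
      finally show ?thesis
        using Jdiff[OF t] \<open>0 < \<epsilon>\<close> \<open>\<epsilon> \<le> J0\<close> by simp
    qed
  qed
qed

end
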